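(* Let $p\ge2$, $p\in\mathbb{N}$, let $I$ be a nondegenerate, compact interval of $\mathbb{R}$, and let $(\boldsymbol{\xi}_n:=(\xi_n^{(1)},\ldots,\xi_n^{(p-1)}))_{n\in\mathbb{N}}$ be a sequence of independent and identically distributed $\mathbb{R}_+^{p-1}$-valued random variables on a probability space $(\Omega,\mathcal{A},\mathbb{P})$ such that $\mathbb{P}(\xi_1^{(1)}+\cdots+\xi_1^{(p-1)}\le1)=1$. For each $n\in\mathbb{N}$, let $M_n:\Omega\to\mathcal{M}_p$, $$(M_n(\omega))(x_1,\ldots,x_p):=\xi_n^{(1)}(\omega)x_1+\cdots+\xi_n^{(p-1)}(\omega)x_{p-1}+\big(1-\xi_n^{(1)}(\omega)-\cdots-\xi_n^{(p-1)}(\omega)\big)x_p$$ for $\omega\in\Omega$ and $x_1,\ldots,x_p\in I$. Then for each $n\in\mathbb{N}$, $M_n$ is a random mean generated by $\boldsymbol{\xi}_n$, and $$\mathbb{P}\Big(\big\{\omega\in\Omega:\lim_{n\to\infty}\kappa_n(\omega)=0\big\}\Big)=1,$$ where $$\kappa_n(\omega):=\sup_{x\in I^p}\Big|\frac1n\sum_{j=1}^n (M_j(\omega))(x)-(\mathbb{E}(M_1))(x)\Big|,\qquad \omega\in\Omega,$$ with $$(\mathbb{E}(M_1))(x_1,\ldots,x_p)=\sum_{i=1}^{p-1}x_i\,\mathbb{E}(\xi_1^{(i)})+x_p\Big(1-\sum_{i=1}^{p-1}\mathbb{E}(\xi_1^{(i)})\Big),\qquad x_1,\ldots,x_p\in I.$$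 Further, $$\sqrt n\,\kappa_n\ \stackrel{\mathcal{D}}{\longrightarrow}\ \sup_{x_1,\ldots,x_p\in I}\left|\left\langle\mathcal{N}_{p-1}\big(\mathbf{0},\operatorname{Cov}(\boldsymbol{\xi}_n)\big),\begin{pmatrix}x_1-x_p\\ \vdots\\ x_{p-1}-x_p\end{pmatrix}\right\rangle\right|$$ as $n\to\infty$, where $\operatorname{Cov}(\boldsymbol{\xi}_n)$ denotes the covariance matrix of $\boldsymbol{\xi}_n$ (which does not depend on $n$, since the $\boldsymbol{\xi}_n$ are identically distributed).
   Context: $\mathbb{N}$ is the set of positive integers and $\mathbb{R}_+=[0,\infty)$. A nondegenerate interval is one containing at least two distinct points. $\mathcal{B}(\cdot)$ denotes the Borel $\sigma$-algebra. $\mathcal{C}(I^p)$ is the Banach space of real-valued continuous functions on $I^p$ with the supremum norm. $\langle\cdot,\cdot\rangle$ is the Euclidean inner product, $\stackrel{\mathcal{D}}{\longrightarrow}$ denotes convergence in distribution, and $\mathcal{N}_{p-1}(\mathbf{0},\mathbf{Q})$ in the limit denotes a random vector having the (possibly degenerate) $(p-1)$-dimensional normal distribution with mean vector $\mathbf{0}$ and covariance matrix $\mathbf{Q}$. $\mathcal{M}_p\subset\mathcal{C}(I^p)$ is the set of $p$-variable (continuous) means on $I$: those $m\in\mathcal{C}(I^p)$ with $\min(x)\le m(x)\le\max(x)$ for all $x\in I^p$, where $\min(x)$ and $\max(x)$ are the minimum and maximum of the coordinates of $x$. Definition (random mean generated by $\xi$). Let $\xi:\Omega\to\mathbb{R}^d$,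 $d\in\mathbb{N}$, be a random variable on $(\Omega,\mathcal{A},\mathbb{P})$. A map $M:\Omega\to\mathcal{M}_p$ is called a ($p$-variable, continuous) random mean (in $I$) generated by $\xi$ if: (i) $M$ is $(\mathcal{A},\mathcal{B}(\mathcal{C}(I^p)))$-measurable; and (ii) there is a $(\mathcal{B}(I^p)\times\mathcal{B}(\mathbb{R}^d),\mathcal{B}(I))$-measurable map $M_\xi:I^p\times\mathbb{R}^d\to I$ such that (a) for every $\omega\in\Omega$ the map $I^p\ni x\mapsto M_\xi(x,\xi(\omega))$ is in $\mathcal{C}(I^p)$, and (b) $\mathbb{P}(\{\omega\in\Omega:(M(\omega))(x)=M_\xi(x,\xi(\omega))\text{ for every }x\in I^p\})=1$. Expected value. For such an $M$, $\mathbb{E}(M):=\int_\Omega M(\omega)\,\mathrm{d}\mathbb{P}(\omega)\in\mathcal{C}(I^p)$ is the Bochner integral of $M$ regarded as a map into $\mathcal{C}(I^p)$.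
   Formalization: On the null event where the coordinates of ξ_n sum to more than 1, the displayed formula is not a mean, so M_n(ω) is there set to an arbitrary fixed mean m_0; elsewhere M_n is exactly as displayed. *)

theory Defs
  imports "HOL-Probability.Probability"
begin

(* Points of R^d are functions on {1..d} that are "undefined" elsewhere. *)
abbreviation Rd :: "nat \<Rightarrow> (nat \<Rightarrow> real) measure" where
  "Rd d \<equiv> Pi\<^sub>M {1..d} (\<lambda>_. borel)"

abbreviation cube :: "nat \<Rightarrow> real set \<Rightarrow> (nat \<Rightarrow> real) set" where
  "cube p I \<equiv> {1..p} \<rightarrow>\<^sub>E I"

abbreviation cube_topology :: "nat \<Rightarrow> real set \<Rightarrow> (nat \<Rightarrow> real) topology" where
  "cube_topology p I \<equiv> product_topology (\<lambda>_. top_of_set I) {1..p}"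

(* This product sigma-algebra is the Borel sigma-algebra of I^p (for I = UNIV, of R^p);
   see sets_cube_borel and sets_Rd below. *)
abbreviation cube_borel :: "nat \<Rightarrow> real set \<Rightarrow> (nat \<Rightarrow> real) measure" where
  "cube_borel p I \<equiv> Pi\<^sub>M {1..p} (\<lambda>_. restrict_space borel I)"

definition borel_of :: "'a topology \<Rightarrow> 'a measure" where
  "borel_of X = sigma (topspace X) {U. openin X U}"

lemma space_borel_of [simp]: "space (borel_of X) = topspace X"
  unfolding borel_of_def by (rule space_measure_of) (auto dest: openin_subset)

lemma sets_borel_of: "sets (borel_of X) = sigma_sets (topspace X) {U. openin X U}"
  unfolding borel_of_def by (rule sets_measure_of) (auto dest: openin_subset)

lemma sets_cube_borel: "sets (cube_borel p I) = sets (borel_of (cube_topology p I))"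
proof (rule antisym)
  have "(\<lambda>x. x) \<in> borel_of (cube_topology p I) \<rightarrow>\<^sub>M cube_borel p I"
  proof (rule measurable_PiM_single')
    show "(\<lambda>x. x) \<in> space (borel_of (cube_topology p I)) \<rightarrow> {1..p} \<rightarrow>\<^sub>E space (restrict_space borel I)"
      by (auto simp: space_restrict_space)
    fix i assume i: "i \<in> {1..p}"
    have "(\<lambda>x. x i) \<in> borel_measurable (borel_of (cube_topology p I))"
    proof (rule borel_measurableI)
      fix S :: "real set" assume S: "open S"
      have "continuous_map (cube_topology p I) (top_of_set I) (\<lambda>x. x i)"
        using i by (rule continuous_map_product_projection)
      then have "continuous_map (cube_topology p I) euclidean (\<lambda>x. x i)"
        by (rule continuous_map_into_fulltopology)
      then have "openin (cube_topology p I) {x \<in> topspace (cube_topology p I). x i \<in> S}"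
        using S by (auto simp: continuous_map_def)
      then show "(\<lambda>x. x i) -` S \<inter> space (borel_of (cube_topology p I)) \<in> sets (borel_of (cube_topology p I))"
        unfolding sets_borel_of
        by (intro sigma_sets.Basic) (simp add: vimage_def Int_def conj_commute)
    qed
    then show "(\<lambda>x. x i) \<in> borel_of (cube_topology p I) \<rightarrow>\<^sub>M restrict_space borel I"
      using i by (intro measurable_restrict_space2) auto
  qed
  note meas = this
  show "sets (cube_borel p I) \<subseteq> sets (borel_of (cube_topology p I))"
  proof
    fix A assume A: "A \<in> sets (cube_borel p I)"
    then have "A \<subseteq> cube p I"
      using sets.sets_into_space[OF A] by (simp add: space_PiM space_restrict_space)
    then show "A \<in> sets (borel_of (cube_topology p I))"
      using measurable_sets[OF meas A] by (simp add: Int_absorb2)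
  qed
next
  have incl: "(\<lambda>x. x) \<in> cube_borel p I \<rightarrow>\<^sub>M (borel :: (nat \<Rightarrow> real) measure)"
  proof (rule measurable_coordinatewise_then_product)
    fix i :: nat
    show "(\<lambda>x. x i) \<in> borel_measurable (cube_borel p I)"
    proof (cases "i \<in> {1..p}")
      case True
      have "(\<lambda>x. x i) \<in> cube_borel p I \<rightarrow>\<^sub>M restrict_space borel I"
        using True by (rule measurable_component_singleton)
      then show ?thesis
        by (simp add: measurable_restrict_space2_iff)
    next
      case False
      have "(\<lambda>x. undefined) \<in> borel_measurable (cube_borel p I)"
        by simp
      then show ?thesis
        by (rule measurable_cong[THEN iffD1, rotated])
           (use False in \<open>auto simp: space_PiM PiE_def extensional_def\<close>)
    qed
  qed
  have "U \<in> sets (cube_borel p I)" if U: "openin (cube_topology p I) U" for U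
  proof -
    let ?E = "{x::nat \<Rightarrow> real. \<forall>i\<in>{1..p}. x i \<in> I}"
    let ?r = "\<lambda>x::nat \<Rightarrow> real. restrict x {1..p}"
    have "continuous_map (top_of_set ?E) (cube_topology p I) ?r"
      unfolding continuous_map_componentwise
      by (auto simp: continuous_map_in_subtopology
               intro!: continuous_on_product_coordinates
               intro: continuous_on_subset[OF continuous_on_product_coordinates])
    then have "openin (top_of_set ?E) {x \<in> ?E. ?r x \<in> U}"
      using U by (auto simp: continuous_map_def)
    then obtain V where V: "open V" "{x \<in> ?E. ?r x \<in> U} = ?E \<inter> V"
      by (auto simp: openin_open)
    have "U = V \<inter> space (cube_borel p I)"
    proof -
      have "x \<in> U \<longleftrightarrow> x \<in> V" if "x \<in> cube p I" for x
      proof -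
        have "?r x = x" "x \<in> ?E" using that by (auto simp: PiE_restrict)
        then show ?thesis using V(2) by (metis (no_types, lifting) Int_iff mem_Collect_eq)
      qed
      moreover have "U \<subseteq> cube p I"
        using openin_subset[OF U] by simp
      ultimately show ?thesis
        by (auto simp: space_PiM space_restrict_space)
    qed
    also have "\<dots> \<in> sets (cube_borel p I)"
      using measurable_sets[OF incl, of V] V(1) by simp
    finally show ?thesis .
  qed
  then show "sets (borel_of (cube_topology p I)) \<subseteq> sets (cube_borel p I)"
    unfolding sets_borel_of
    using sets.top[of "cube_borel p I"]
    by (intro sets.sigma_sets_subset') (auto simp: space_PiM space_restrict_space)
qed

lemma sets_Rd: "sets (Rd d) = sets (borel_of (product_topology (\<lambda>_. euclideanreal) {1..d}))"
proof -
  have "sets (Rd d) = sets (cube_borel d UNIV)"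
    by (rule sets_PiM_cong) (simp_all add: sets_restrict_space)
  then show ?thesis
    by (simp only: sets_cube_borel subtopology_UNIV)
qed

(* Boundedness in the library's cfunspace is automatic here for compact I, so this is C(I^p)
   with the supremum metric; its elements are "undefined" outside I^p. *)
definition CI :: "nat \<Rightarrow> real set \<Rightarrow> ((nat \<Rightarrow> real) \<Rightarrow> real) metric" where
  "CI p I = cfunspace (cube_topology p I) euclidean_metric"

definition means :: "nat \<Rightarrow> real set \<Rightarrow> ((nat \<Rightarrow> real) \<Rightarrow> real) set" where
  "means p I = {m \<in> mspace (CI p I).
     \<forall>x\<in>cube p I. Min (x ` {1..p}) \<le> m x \<and> m x \<le> Max (x ` {1..p})}"

definition random_mean ::
  "'w measure \<Rightarrow> nat \<Rightarrow> real set \<Rightarrow> nat \<Rightarrow> ('w \<Rightarrow> nat \<Rightarrow> real) \<Rightarrow> ('w \<Rightarrow> (nat \<Rightarrow> real) \<Rightarrow> real) \<Rightarrow> bool"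
where
  "random_mean P p I d \<xi> M \<longleftrightarrow>
     \<xi> \<in> P \<rightarrow>\<^sub>M Rd d \<and>
     (\<forall>\<omega>\<in>space P. M \<omega> \<in> means p I) \<and>
     M \<in> P \<rightarrow>\<^sub>M borel_of (mtopology_of (CI p I)) \<and>
     (\<exists>M\<xi>. (\<lambda>(x, y). M\<xi> x y) \<in> cube_borel p I \<Otimes>\<^sub>M Rd d \<rightarrow>\<^sub>M restrict_space borel I \<and>
        (\<forall>\<omega>\<in>space P. continuous_map (cube_topology p I) euclideanreal (\<lambda>x. M\<xi> x (\<xi> \<omega>))) \<and>
        \<P>(\<omega> in P. \<forall>x\<in>cube p I. M \<omega> x = M\<xi> x (\<xi> \<omega>)) = 1)"

(* Bochner integral in C(I^p) on a probability space. The definition follows the library's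
   has_bochner_integral, which needs a type of class real_normed_vector, whereas C(I^p) depends
   on p and I. *)
definition simple_expectation ::
  "'w measure \<Rightarrow> nat \<Rightarrow> real set \<Rightarrow> ('w \<Rightarrow> (nat \<Rightarrow> real) \<Rightarrow> real) \<Rightarrow> (nat \<Rightarrow> real) \<Rightarrow> real"
where
  "simple_expectation P p I S =
     (\<lambda>x\<in>cube p I. \<Sum>f\<in>S ` space P. measure P {\<omega> \<in> space P. S \<omega> = f} * f x)"

definition has_bochner_expectation ::
  "'w measure \<Rightarrow> nat \<Rightarrow> real set \<Rightarrow> ('w \<Rightarrow> (nat \<Rightarrow> real) \<Rightarrow> real) \<Rightarrow> ((nat \<Rightarrow> real) \<Rightarrow> real) \<Rightarrow> bool"
where
  "has_bochner_expectation P p I M m \<longleftrightarrow>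
     M \<in> P \<rightarrow>\<^sub>M borel_of (mtopology_of (CI p I)) \<and>
     (\<exists>S. (\<forall>k. simple_function P (S k) \<and> S k ` space P \<subseteq> mspace (CI p I)) \<and>
        (\<lambda>k::nat. \<integral>\<^sup>+\<omega>. ennreal (mdist (CI p I) (M \<omega>) (S k \<omega>)) \<partial>P) \<longlonglongrightarrow> 0 \<and>
        limitin (mtopology_of (CI p I)) (\<lambda>k. simple_expectation P p I (S k)) m sequentially)"

definition bochner_expectation ::
  "'w measure \<Rightarrow> nat \<Rightarrow> real set \<Rightarrow> ('w \<Rightarrow> (nat \<Rightarrow> real) \<Rightarrow> real) \<Rightarrow> (nat \<Rightarrow> real) \<Rightarrow> real"
where
  "bochner_expectation P p I M = (THE m. has_bochner_expectation P p I M m)"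

definition kappa ::
  "'w measure \<Rightarrow> nat \<Rightarrow> real set \<Rightarrow> (nat \<Rightarrow> 'w \<Rightarrow> (nat \<Rightarrow> real) \<Rightarrow> real) \<Rightarrow> nat \<Rightarrow> 'w \<Rightarrow> real"
where
  "kappa P p I M n \<omega> =
     (SUP x\<in>cube p I. \<bar>1 / real n * (\<Sum>j=1..n. M j \<omega> x) - bochner_expectation P p I (M 1) x\<bar>)"

definition Cov :: "'w measure \<Rightarrow> ('w \<Rightarrow> nat \<Rightarrow> real) \<Rightarrow> nat \<Rightarrow> nat \<Rightarrow> real" where
  "Cov P \<xi> i k =
     (\<integral>\<omega>. (\<xi> \<omega> i - (\<integral>\<omega>'. \<xi> \<omega>' i \<partial>P)) * (\<xi> \<omega> k - (\<integral>\<omega>'. \<xi> \<omega>' k \<partial>P)) \<partial>P)"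

(* nu is the d-dimensional normal law N(mu, Q). It is specified by its characteristic function,
   so that singular Q are covered. *)
definition normal_law ::
  "nat \<Rightarrow> (nat \<Rightarrow> real) \<Rightarrow> (nat \<Rightarrow> nat \<Rightarrow> real) \<Rightarrow> (nat \<Rightarrow> real) measure \<Rightarrow> bool"
where
  "normal_law d \<mu> Q \<nu> \<longleftrightarrow>
     prob_space \<nu> \<and> sets \<nu> = sets (Rd d) \<and>
     (\<forall>t::nat \<Rightarrow> real.
        (\<integral>z. iexp (\<Sum>i=1..d. t i * z i) \<partial>\<nu>) =
        exp (\<i> * of_real (\<Sum>i=1..d. t i * \<mu> i)
             - of_real ((\<Sum>i=1..d. \<Sum>k=1..d. t i * Q i k * t k) / 2)))"

end

theory Submission
  imports Defs
begin

text \<open>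
  Up to a null set, \<open>M\<^sub>n(x) = x\<^sub>p + \<langle>\<xi>\<^sub>n, x - x\<^sub>p\<rangle>\<close> depends affinely on \<open>\<xi>\<^sub>n\<close>, so
  \<open>\<kappa>\<^sub>n = G (n\<^sup>-\<^sup>1 \<Sum> \<xi>\<^sub>j - E \<xi>\<^sub>1)\<close> where \<open>G z = sup\<^sub>x \<bar>\<langle>z, x - x\<^sub>p\<rangle>\<bar>\<close>. For \<open>I = [a, b]\<close> this is
  \<open>G z = (b - a) / 2 * (\<Sum> \<bar>z\<^sub>i\<bar> + \<bar>\<Sum> z\<^sub>i\<bar>)\<close>, a Lipschitz and positively homogeneous function.
  Almost sure convergence follows from the strong law for bounded variables (Hoeffding and
  Borel-Cantelli). The distributional limit is the continuous image under \<open>G\<close> of the multivariate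
  central limit theorem. Since the latter has to identify an arbitrary law by its characteristic
  function, it is obtained from pointwise convergence of characteristic functions: a Lipschitz test
  function is approximated by trigonometric polynomials, using Stone-Weierstrass on a large cube and
  the uniform bound on second moments.
\<close>

text \<open>Lipschitz test functions suffice because weak convergence on the line can be tested on
  the piecewise linear functions \<open>cts_step\<close>, and \<open>cts_step\<close> composed with
  \<open>G\<close> is bounded and Lipschitz in finitely many coordinates. Homogeneity of
  \<open>G\<close> is what turns \<open>sqrt n\<close> times \<open>kappa\<close> into
  \<open>G\<close> of the normalized sum. The covariance matrix may be singular, which rules out
  densities: the normal law is built as a linear image of independent standard normals, and the
  one-dimensional limit theorem has a separate case of variance zero. Two obstacles come from the
  setting. The expectation in C(I^p) is a definite description, so an approximating sequence of
  simple functions must be exhibited and uniqueness must be shown; uniqueness comes from point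
  evaluations. And the closed form of \<open>kappa\<close> holds only off a null set of a space that
  is not assumed complete, so measurability of \<open>kappa\<close> has its own proof, through a
  countable dense set of points.\<close>

section \<open>Existence of normal laws\<close>

text \<open>A Cholesky factorization that also covers singular \<open>Q\<close>. The induction
  splits off the last coordinate: completing the square in it leaves a form that is again
  nonnegative.\<close>

lemma psd_factor:
  fixes Q :: "nat \<Rightarrow> nat \<Rightarrow> real"
  assumes "\<And>i k. i \<in> {1..d} \<Longrightarrow> k \<in> {1..d} \<Longrightarrow> Q i k = Q k i"
    and "\<And>t. (\<Sum>i=1..d. \<Sum>k=1..d. t i * Q i k * t k) \<ge> 0"
  shows "\<exists>A. \<forall>i\<in>{1..d}. \<forall>k\<in>{1..d}. Q i k = (\<Sum>j=1..d. A i j * A k j)"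
  using assms
proof (induction d arbitrary: Q)
  case 0
  then show ?case by simp
next
  case (Suc d)
  define q where "q = Q (Suc d) (Suc d)"
  \<comment> \<open>Schur complement; for \<open>q = 0\<close> the junk value of the quotient gives \<open>Q' = Q\<close>, which is what is needed
    because the last row of \<open>Q\<close> then vanishes.\<close>
  define Q' where "Q' i k = Q i k - Q i (Suc d) * Q k (Suc d) / q" for i k
  have sym: "Q i k = Q k i" if "i \<in> {1..Suc d}" "k \<in> {1..Suc d}" for i k
    using Suc.prems(1) that by blast
  have form: "(\<Sum>i=1..Suc d. \<Sum>k=1..Suc d. t i * Q i k * t k) =
      (\<Sum>i=1..d. \<Sum>k=1..d. t i * Q i k * t k) + 2 * t (Suc d) * (\<Sum>i=1..d. t i * Q i (Suc d)) + (t (Suc d))\<^sup>2 * q"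
    for t
  proof -
    have "(\<Sum>k=1..d. t (Suc d) * Q (Suc d) k * t k) = t (Suc d) * (\<Sum>i=1..d. t i * Q i (Suc d))"
      unfolding sum_distrib_left by (rule sum.cong) (auto simp: sym[of "Suc d"])
    moreover have "(\<Sum>i=1..d. t i * Q i (Suc d) * t (Suc d)) = t (Suc d) * (\<Sum>i=1..d. t i * Q i (Suc d))"
      by (simp add: sum_distrib_left mult_ac)
    ultimately show ?thesis
      by (simp add: sum.distrib power2_eq_square q_def mult_ac)
  qed
  have q0: "q \<ge> 0"
    using form[of "\<lambda>i. if i = Suc d then 1 else 0"] Suc.prems(2)[of "\<lambda>i. if i = Suc d then 1 else 0"]
    by simp
  \<comment> \<open>When \<open>q = 0\<close>, the form at the i-th unit vector plus
    \<open>s\<close> times the last one is affine in \<open>s\<close> with slope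
    \<open>2 * Q i (Suc d)\<close>. A nonzero slope would allow the value -1, and \<open>s\<close>
    is solved for exactly that.\<close>
  have zero: "Q i (Suc d) = 0" if "q = 0" "i \<in> {1..d}" for i
  proof (rule ccontr)
    assume ne: "Q i (Suc d) \<noteq> 0"
    define s where "s = - (Q i i + 1) / (2 * Q i (Suc d))"
    define t where "t k = (if k = i then 1 else if k = Suc d then s else 0)" for k
    have "(\<Sum>j=1..d. t j * c j) = c i" for c :: "nat \<Rightarrow> real"
    proof -
      have "(\<Sum>j=1..d. t j * c j) = (\<Sum>j=1..d. if j = i then c j else 0)"
        by (rule sum.cong) (auto simp: t_def)
      then show ?thesis using that(2) by simp
    qed
    note pick = this
    have "(\<Sum>i=1..Suc d. \<Sum>k=1..Suc d. t i * Q i k * t k) = Q i i + 2 * s * Q i (Suc d)"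
    proof -
      have "(\<Sum>j=1..d. \<Sum>k=1..d. t j * Q j k * t k) = (\<Sum>j=1..d. t j * (\<Sum>k=1..d. t k * Q j k))"
        by (simp add: sum_distrib_left mult_ac)
      then show ?thesis unfolding form using that by (simp add: pick del: One_nat_def) (auto simp: t_def)
    qed
    also have "\<dots> = -1" using ne by (simp add: s_def field_simps)
    finally show False using Suc.prems(2)[of t] by linarith
  qed
  have "\<exists>A. \<forall>i\<in>{1..d}. \<forall>k\<in>{1..d}. Q' i k = (\<Sum>j=1..d. A i j * A k j)"
  proof (rule Suc.IH)
    show "Q' i k = Q' k i" if "i \<in> {1..d}" "k \<in> {1..d}" for i k
      using sym[of i k] that by (simp add: Q'_def)
    fix t :: "nat \<Rightarrow> real"
    let ?u = "\<Sum>i=1..d. t i * Q i (Suc d)"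
    \<comment> \<open>For \<open>q > 0\<close> this last coordinate minimizes the form of
      \<open>Q\<close> with the others fixed, and the minimum is the form of \<open>Q'\<close> at
      \<open>t\<close>. For \<open>q = 0\<close> the quotient is 0 and the last coordinate drops
      out.\<close>
    define t' where "t' i = (if i = Suc d then - ?u / q else t i)" for i
    have sq: "(\<Sum>i=1..d. \<Sum>k=1..d. t i * (Q i (Suc d) * Q k (Suc d) / q) * t k) = ?u\<^sup>2 / q"
      unfolding power2_eq_square sum_product sum_divide_distrib by (simp add: mult_ac)
    have "0 \<le> (\<Sum>i=1..Suc d. \<Sum>k=1..Suc d. t' i * Q i k * t' k)"
      by (rule Suc.prems(2))
    also have "\<dots> = (\<Sum>i=1..d. \<Sum>k=1..d. t i * Q i k * t k) + 2 * (- ?u / q) * ?u + (?u / q)\<^sup>2 * q"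
      unfolding form by (simp add: t'_def)
    also have "\<dots> = (\<Sum>i=1..d. \<Sum>k=1..d. t i * Q i k * t k) - ?u\<^sup>2 / q"
      by (cases "q = 0") (simp_all add: field_simps power2_eq_square)
    also have "\<dots> = (\<Sum>i=1..d. \<Sum>k=1..d. t i * Q' i k * t k)"
      unfolding sq[symmetric] Q'_def by (simp add: left_diff_distrib right_diff_distrib sum_subtractf)
    finally show "0 \<le> (\<Sum>i=1..d. \<Sum>k=1..d. t i * Q' i k * t k)" .
  qed
  then obtain A where A: "\<And>i k. i \<in> {1..d} \<Longrightarrow> k \<in> {1..d} \<Longrightarrow> Q' i k = (\<Sum>j=1..d. A i j * A k j)"
    by blast
  \<comment> \<open>The last column restores the rank one term subtracted in \<open>Q'\<close>; the
    last row vanishes elsewhere, so the columns of \<open>A\<close> contribute only to the upper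
    block.\<close>
  define B where "B i j = (if j = Suc d then (if i = Suc d then sqrt q else Q i (Suc d) / sqrt q)
      else if i = Suc d then 0 else A i j)" for i j
  have "Q i k = (\<Sum>j=1..Suc d. B i j * B k j)" if "i \<in> {1..Suc d}" "k \<in> {1..Suc d}" for i k
  proof -
    have S: "(\<Sum>j=1..d. B i j * B k j) = (if i = Suc d \<or> k = Suc d then 0 else Q' i k)"
    proof (cases "i = Suc d \<or> k = Suc d")
      case True
      then show ?thesis by (auto simp: B_def intro!: sum.neutral)
    next
      case False
      then have "(\<Sum>j=1..d. B i j * B k j) = (\<Sum>j=1..d. A i j * A k j)"
        by (intro sum.cong) (auto simp: B_def)
      then show ?thesis using False A[of i k] that by auto
    qed
    show ?thesis
    proof (cases "q = 0")
      case True
      then have "Q i (Suc d) = 0" "Q k (Suc d) = 0"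
        using zero[of i] zero[of k] that q_def by (metis True atLeastAtMostSuc_conv insertE Suc_eq_plus1 le_add2)+
      then show ?thesis using True S sym[of i k] that
        by (auto simp: Q'_def B_def)
    next
      case False
      with q0 have "sqrt q * sqrt q = q" "q > 0" by auto
      then show ?thesis using False S sym[of i k] that
        by (auto simp: Q'_def B_def q_def field_simps)
    qed
  qed
  then show ?case by blast
qed

text \<open>With \<open>Q = A A^T\<close>, the law of \<open>A g\<close> for a standard normal
  vector \<open>g\<close> works: at \<open>t\<close> its characteristic function is a product of
  one-dimensional ones at the coordinates \<open>s\<close> of \<open>A^T t\<close>, and the squares
  of these coordinates sum to the quadratic form of \<open>Q\<close> at \<open>t\<close>.\<close>

lemma normal_law_exists:
  fixes Q :: "nat \<Rightarrow> nat \<Rightarrow> real"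
  assumes "\<And>i k. i \<in> {1..d} \<Longrightarrow> k \<in> {1..d} \<Longrightarrow> Q i k = Q k i"
    and "\<And>t. (\<Sum>i=1..d. \<Sum>k=1..d. t i * Q i k * t k) \<ge> 0"
  shows "\<exists>\<nu>. normal_law d (\<lambda>_. 0) Q \<nu>"
proof -
  obtain A where A: "\<And>i k. i \<in> {1..d} \<Longrightarrow> k \<in> {1..d} \<Longrightarrow> Q i k = (\<Sum>j=1..d. A i j * A k j)"
    using psd_factor[of d Q] assms by blast
  let ?N = "\<lambda>_::nat. std_normal_distribution"
  interpret N: real_distribution std_normal_distribution
    by (rule real_dist_normal_dist)
  interpret product_prob_space ?N "{1..d}" ..
  let ?G = "Pi\<^sub>M {1..d} ?N"
  let ?L = "\<lambda>z. \<lambda>i\<in>{1..d}. \<Sum>j=1..d. A i j * z j"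
  have "(\<lambda>z. z j) \<in> borel_measurable ?G" if "j \<in> {1..d}" for j
    using measurable_component_singleton[OF that, of ?N] by simp
  then have L: "?L \<in> ?G \<rightarrow>\<^sub>M Rd d"
    by (intro measurable_restrict borel_measurable_sum borel_measurable_times measurable_const) (simp_all only: space_borel UNIV_I)
  define \<nu> where "\<nu> = distr ?G (Rd d) ?L"
  have "(\<integral>z. iexp (\<Sum>i=1..d. t i * z i) \<partial>\<nu>) =
      exp (\<i> * of_real (\<Sum>i=1..d. t i * 0) - of_real ((\<Sum>i=1..d. \<Sum>k=1..d. t i * Q i k * t k) / 2))" for t
  proof -
    define s where "s j = (\<Sum>i=1..d. t i * A i j)" for j
    have "(\<integral>z. iexp (\<Sum>i=1..d. t i * z i) \<partial>\<nu>) = (\<integral>z. iexp (\<Sum>i=1..d. t i * ?L z i) \<partial>?G)"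
      unfolding \<nu>_def using L by (rule integral_distr) measurable
    also have "\<dots> = (\<integral>z. (\<Prod>j\<in>{1..d}. iexp (s j * z j)) \<partial>?G)"
    proof (rule Bochner_Integration.integral_cong[OF refl])
      fix z
      have "(\<Sum>i=1..d. t i * ?L z i) = (\<Sum>i=1..d. \<Sum>j=1..d. t i * A i j * z j)"
        by (simp add: sum_distrib_left mult_ac)
      also have "\<dots> = (\<Sum>j=1..d. s j * z j)"
        unfolding s_def sum_distrib_right by (rule sum.swap)
      finally show "iexp (\<Sum>i=1..d. t i * ?L z i) = (\<Prod>j\<in>{1..d}. iexp (s j * z j))"
        by (simp add: exp_sum sum_distrib_left del: restrict_apply)
    qed
    also have "\<dots> = (\<Prod>j\<in>{1..d}. char std_normal_distribution (s j))"
      unfolding char_def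
      by (rule product_integral_prod) (auto intro!: N.integrable_iexp)
    also have "\<dots> = exp (\<Sum>j=1..d. of_real (- (s j)\<^sup>2 / 2))"
      by (simp add: char_std_normal_distribution exp_sum flip: exp_of_real)
    also have "(\<Sum>j=1..d. complex_of_real (- (s j)\<^sup>2 / 2)) = - of_real ((\<Sum>j=1..d. (s j)\<^sup>2) / 2)"
      by (simp add: sum_negf sum_divide_distrib)
    also have "(\<Sum>j=1..d. (s j)\<^sup>2) = (\<Sum>i=1..d. \<Sum>k=1..d. t i * Q i k * t k)"
    proof -
      have "(\<Sum>j=1..d. (s j)\<^sup>2) = (\<Sum>j=1..d. \<Sum>i=1..d. \<Sum>k=1..d. t i * A i j * (t k * A k j))"
        by (simp add: s_def power2_eq_square sum_product)
      also have "\<dots> = (\<Sum>i=1..d. \<Sum>k=1..d. \<Sum>j=1..d. t i * A i j * (t k * A k j))"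
        by (rule trans[OF sum.swap sum.cong[OF refl sum.swap]])
      also have "\<dots> = (\<Sum>i=1..d. \<Sum>k=1..d. t i * Q i k * t k)"
        by (intro sum.cong refl) (simp add: A sum_distrib_left sum_distrib_right mult_ac)
      finally show ?thesis .
    qed
    finally show ?thesis by simp
  qed
  moreover have "prob_space \<nu>"
    unfolding \<nu>_def by (rule prob_space_distr[OF L])
  ultimately have "normal_law d (\<lambda>_. 0) Q \<nu>"
    by (simp add: normal_law_def \<nu>_def)
  then show ?thesis ..
qed

section \<open>Convergence of characteristic functions and of integrals\<close>

text \<open>The integral of such a function is a finite linear combination of values of the
  characteristic function, so pointwise convergence of the latter carries over to it. Complex
  coefficients are allowed in order to contain sines.\<close>

inductive_set trig_poly :: "nat \<Rightarrow> ((nat \<Rightarrow> real) \<Rightarrow> complex) set" for d where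
  char: "(\<lambda>z. c * iexp (\<Sum>i=1..d. t i * z i)) \<in> trig_poly d"
| add: "f \<in> trig_poly d \<Longrightarrow> g \<in> trig_poly d \<Longrightarrow> (\<lambda>z. f z + g z) \<in> trig_poly d"

text \<open>Frequencies add under multiplication. This is the algebra property that
  Stone-Weierstrass asks for.\<close>

lemma trig_poly_mult:
  assumes "f \<in> trig_poly d" "g \<in> trig_poly d"
  shows "(\<lambda>z. f z * g z) \<in> trig_poly d"
  using assms(1)
proof induction
  case (char c t)
  show ?case
    using assms(2)
  proof induction
    case (char c' t')
    have "(\<lambda>z. (c * c') * iexp (\<Sum>i=1..d. (t i + t' i) * z i)) \<in> trig_poly d"
      by (rule trig_poly.char)
    then show ?case
      by (simp add: exp_add distrib_left distrib_right sum.distrib mult_ac)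
  next
    case (add f g)
    from trig_poly.add[OF add.IH] show ?case by (simp add: distrib_left)
  qed
next
  case (add f g)
  from trig_poly.add[OF add.IH] show ?case by (simp add: distrib_right)
qed

lemma trig_poly_const: "(\<lambda>_. c) \<in> trig_poly d"
  using trig_poly.char[of c "\<lambda>_. 0" d] by simp

text \<open>Euler's formula. Sines of single coordinates are the components of the truncation map
  used below.\<close>

lemma trig_poly_sin:
  assumes "k \<in> {1..d}"
  shows "(\<lambda>z. of_real (sin (s * z k))) \<in> trig_poly d"
proof -
  have pick: "(\<Sum>i=1..d. (if i = k then r else 0) * z i) = r * z k" for r and z :: "nat \<Rightarrow> real"
  proof -
    have "(\<Sum>i=1..d. (if i = k then r else 0) * z i) = (\<Sum>i=1..d. if i = k then r * z i else 0)"
      by (rule sum.cong) auto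
    then show ?thesis using assms by simp
  qed
  have "(\<lambda>z. - \<i> / 2 * iexp (s * z k) + \<i> / 2 * iexp (- s * z k)) \<in> trig_poly d"
    using trig_poly.add[OF trig_poly.char[of "- \<i> / 2" "\<lambda>i. if i = k then s else 0" d]
        trig_poly.char[of "\<i> / 2" "\<lambda>i. if i = k then - s else 0" d]]
    unfolding pick .
  moreover have "- \<i> / 2 * iexp (s * z k) + \<i> / 2 * iexp (- s * z k) = of_real (sin (s * z k))" for z
    by (simp add: complex_eq_iff Re_exp Im_exp)
  ultimately show ?thesis by simp
qed

lemma integrable_trig_poly:
  assumes "prob_space \<nu>" and sets: "sets \<nu> = sets (Rd d)" and "f \<in> trig_poly d"
  shows "integrable \<nu> f"
  using assms(3)
proof induction
  case (char c t)
  interpret prob_space \<nu> by fact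
  have "(\<lambda>z. \<Sum>i=1..d. t i * z i) \<in> borel_measurable (Rd d)" by measurable
  then have [measurable]: "(\<lambda>z. \<Sum>i=1..d. t i * z i) \<in> borel_measurable \<nu>"
    by (simp cong: measurable_cong_sets add: sets)
  have "(\<lambda>z. complex_of_real (\<Sum>i=1..d. t i * z i)) \<in> borel_measurable \<nu>" by measurable
  then show ?case by (intro integrable_mult_right integrable_iexp Im_complex_of_real)
qed simp

lemma tendsto_integral_trig_poly:
  assumes "\<And>n. prob_space (\<mu> n)" "\<And>n. sets (\<mu> n) = sets (Rd d)"
    and "prob_space \<nu>" "sets \<nu> = sets (Rd d)"
    and lim: "\<And>t. (\<lambda>n. \<integral>z. iexp (\<Sum>i=1..d. t i * z i) \<partial>\<mu> n) \<longlonglongrightarrow> (\<integral>z. iexp (\<Sum>i=1..d. t i * z i) \<partial>\<nu>)"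
    and "f \<in> trig_poly d"
  shows "(\<lambda>n. \<integral>z. f z \<partial>\<mu> n) \<longlonglongrightarrow> (\<integral>z. f z \<partial>\<nu>)"
  using assms(6)
proof induction
  case (char c t)
  show ?case using tendsto_mult_left[OF lim[of t], of c] by simp
next
  case (add f g)
  then show ?case
    using tendsto_add[OF add.IH] integrable_trig_poly[OF assms(1,2)] integrable_trig_poly[OF assms(3,4)]
    by simp
qed

text \<open>The quadratic bound is chosen to match second moments; a cubic one would call for third
  moments.\<close>

lemma abs_sin_diff_le: "\<bar>sin u - u\<bar> \<le> (u::real)\<^sup>2"
proof -
  have "\<bar>sin u - (\<Sum>m<2. sin_coeff m * u ^ m)\<bar> \<le> inverse (fact 2) * \<bar>u\<bar> ^ 2"
    by (rule Maclaurin_sin_bound)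
  also have "\<dots> \<le> u\<^sup>2" by simp
  finally show ?thesis by (simp add: numeral_2_eq_2 sin_coeff_def)
qed

text \<open>A d-dimensional continuity theorem in which the limit law is given in advance, so that
  no compactness argument for measures enters. The common bound \<open>B\<close> on second moments
  does the work of tightness.\<close>

lemma char_tendsto_imp_integral_tendsto:
  fixes \<mu> :: "nat \<Rightarrow> (nat \<Rightarrow> real) measure" and g :: "(nat \<Rightarrow> real) \<Rightarrow> real"
  assumes \<mu>: "\<And>n. prob_space (\<mu> n)" "\<And>n. sets (\<mu> n) = sets (Rd d)"
    and \<nu>: "prob_space \<nu>" "sets \<nu> = sets (Rd d)"
    and lim: "\<And>t. (\<lambda>n. \<integral>z. iexp (\<Sum>i=1..d. t i * z i) \<partial>\<mu> n) \<longlonglongrightarrow> (\<integral>z. iexp (\<Sum>i=1..d. t i * z i) \<partial>\<nu>)"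
    and int: "\<And>n i. i \<in> {1..d} \<Longrightarrow> integrable (\<mu> n) (\<lambda>z. (z i)\<^sup>2)"
    and moment: "\<And>n i. i \<in> {1..d} \<Longrightarrow> (\<integral>z. (z i)\<^sup>2 \<partial>\<mu> n) \<le> B"
    and g: "g \<in> borel_measurable (Rd d)"
    and lip: "\<And>z w. \<bar>g z - g w\<bar> \<le> C * (\<Sum>i=1..d. \<bar>z i - w i\<bar>)" and C: "0 \<le> C"
    and bnd: "\<And>z. \<bar>g z\<bar> \<le> D"
  shows "(\<lambda>n. \<integral>z. g z \<partial>\<mu> n) \<longlonglongrightarrow> (\<integral>z. g z \<partial>\<nu>)"
proof (rule tendstoI)
  fix e :: real assume e: "e > 0"
  \<comment> \<open>\<open>\<tau> K\<close> moves \<open>z\<close> by \<open>O(z\<^sup>2 / K)\<close> into a compact cube, and polynomials in \<open>\<tau> K z\<close> are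
    trigonometric polynomials in \<open>z\<close>; the bounded second moments make the replacement of \<open>g\<close> by
    \<open>g \<circ> \<tau> K\<close> uniformly cheap in \<open>n\<close>.\<close>
  define \<tau> where "\<tau> K z = (\<lambda>i\<in>{1..d}. K * sin (z i / K))" for K and z :: "nat \<Rightarrow> real"
  have \<tau>_meas: "\<tau> K \<in> Rd d \<rightarrow>\<^sub>M Rd d" for K
    unfolding \<tau>_def[abs_def] by (intro measurable_restrict) measurable
  have g\<tau>_meas: "(\<lambda>z. g (\<tau> K z)) \<in> borel_measurable (Rd d)" for K
    using measurable_compose[OF \<tau>_meas g] .
  have g_int: "integrable N g" "integrable N (\<lambda>z. g (\<tau> K z))"
    if "prob_space N" "sets N = sets (Rd d)" for N K
  proof -
    interpret N: prob_space N by fact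
    show "integrable N g" "integrable N (\<lambda>z. g (\<tau> K z))"
      using g g\<tau>_meas[of K] bnd
      by (auto intro!: N.integrable_const_bound[of _ D] simp: that(2) cong: measurable_cong_sets)
  qed
  have near: "\<bar>g (\<tau> K z) - g z\<bar> \<le> C * (\<Sum>i=1..d. (z i)\<^sup>2) / K" if "K > 0" for K z
  proof -
    have "\<bar>\<tau> K z i - z i\<bar> \<le> (z i)\<^sup>2 / K" if "i \<in> {1..d}" for i
    proof -
      have "\<bar>\<tau> K z i - z i\<bar> = K * \<bar>sin (z i / K) - z i / K\<bar>"
        using that \<open>K > 0\<close> by (simp add: \<tau>_def abs_mult_pos' right_diff_distrib)
      also have "\<dots> \<le> K * (z i / K)\<^sup>2"
        using \<open>K > 0\<close> by (intro mult_left_mono abs_sin_diff_le) auto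
      finally show ?thesis using \<open>K > 0\<close> by (simp add: power2_eq_square)
    qed
    then have "C * (\<Sum>i=1..d. \<bar>\<tau> K z i - z i\<bar>) \<le> C * (\<Sum>i=1..d. (z i)\<^sup>2 / K)"
      using C by (intro mult_left_mono sum_mono) auto
    with lip[of "\<tau> K z" z] show ?thesis
      by (simp flip: sum_divide_distrib)
  qed
  \<comment> \<open>The moment bound is available for the \<open>\<mu> n\<close> only. For the
    single measure \<open>\<nu>\<close>, dominated convergence with the constant \<open>D\<close>
    takes its place.\<close>
  have "(\<lambda>m. \<integral>z. g (\<tau> (real (Suc m)) z) \<partial>\<nu>) \<longlonglongrightarrow> (\<integral>z. g z \<partial>\<nu>)"
  proof (rule integral_dominated_convergence[where w="\<lambda>_. D"])
    interpret prob_space \<nu> by fact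
    show "integrable \<nu> (\<lambda>_. D)" by simp
    show "AE z in \<nu>. (\<lambda>m. g (\<tau> (real (Suc m)) z)) \<longlonglongrightarrow> g z"
    proof (rule AE_I2)
      fix z
      have "(\<lambda>m. C * (\<Sum>i=1..d. (z i)\<^sup>2) / real (Suc m)) \<longlonglongrightarrow> 0"
        by (intro LIMSEQ_Suc lim_const_over_n)
      then have "(\<lambda>m. g (\<tau> (real (Suc m)) z) - g z) \<longlonglongrightarrow> 0"
        by (rule Lim_null_comparison[rotated]) (use near in auto)
      then show "(\<lambda>m. g (\<tau> (real (Suc m)) z)) \<longlonglongrightarrow> g z"
        by (rule LIM_zero_cancel)
    qed
  qed (use g g\<tau>_meas bnd \<nu>(2) in \<open>auto cong: measurable_cong_sets\<close>)
  \<comment> \<open>The five shares of \<open>e\<close>: \<open>g\<close> against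
    \<open>g \<circ> \<tau> K\<close> under \<open>\<mu> n\<close> and under \<open>\<nu>\<close>,
    then \<open>g \<circ> \<tau> K\<close> against \<open>T \<circ> \<tau> K\<close> under both, and
    finally \<open>\<mu> n\<close> against \<open>\<nu>\<close> on
    \<open>T \<circ> \<tau> K\<close>.\<close>
  then have "\<forall>\<^sub>F m in sequentially. dist (\<integral>z. g (\<tau> (real (Suc m)) z) \<partial>\<nu>) (\<integral>z. g z \<partial>\<nu>) < e / 5"
    using e by (intro tendstoD) auto
  moreover have "\<forall>\<^sub>F m in sequentially. C * (real d * B) / real (Suc m) < e / 5"
    using e by (intro order_tendstoD(2)[OF LIMSEQ_Suc[OF lim_const_over_n]]) auto
  ultimately have "\<exists>m. dist (\<integral>z. g (\<tau> (real (Suc m)) z) \<partial>\<nu>) (\<integral>z. g z \<partial>\<nu>) < e / 5 \<and>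
      C * (real d * B) / real (Suc m) < e / 5"
    by (intro eventually_happens'[OF sequentially_bot] eventually_conj)
  then obtain m where m: "dist (\<integral>z. g (\<tau> (real (Suc m)) z) \<partial>\<nu>) (\<integral>z. g z \<partial>\<nu>) < e / 5"
      "C * (real d * B) / real (Suc m) < e / 5"
    by blast
  define K where "K = real (Suc m)"
  have K: "K > 0" by (simp add: K_def)
  have \<mu>_near: "\<bar>(\<integral>z. g (\<tau> K z) \<partial>\<mu> n) - (\<integral>z. g z \<partial>\<mu> n)\<bar> < e / 5" for n
  proof -
    interpret prob_space "\<mu> n" by fact
    have "\<bar>(\<integral>z. g (\<tau> K z) \<partial>\<mu> n) - (\<integral>z. g z \<partial>\<mu> n)\<bar> = \<bar>\<integral>z. g (\<tau> K z) - g z \<partial>\<mu> n\<bar>"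
      using g_int[OF \<mu>] by simp
    also have "\<dots> \<le> (\<integral>z. C * (\<Sum>i=1..d. (z i)\<^sup>2) / K \<partial>\<mu> n)"
    proof (rule order_trans[OF integral_abs_bound integral_mono])
      show "integrable (\<mu> n) (\<lambda>z. \<bar>g (\<tau> K z) - g z\<bar>)"
        using g_int[OF \<mu>] by simp
      show "integrable (\<mu> n) (\<lambda>z. C * (\<Sum>i=1..d. (z i)\<^sup>2) / K)"
        using int by (intro integrable_divide_zero integrable_mult_right integrable_sum) auto
    qed (use near K in auto)
    also have "\<dots> = C * (\<Sum>i=1..d. \<integral>z. (z i)\<^sup>2 \<partial>\<mu> n) / K"
      using int by (simp add: Bochner_Integration.integral_sum)
    also have "\<dots> \<le> C * (\<Sum>i=1..d. B) / K"
      using K C moment by (intro divide_right_mono mult_left_mono sum_mono) auto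
    also have "\<dots> < e / 5" using m(2) by (simp add: K_def)
    finally show ?thesis .
  qed
  define S where "S = (\<Pi>\<^sub>E i\<in>{1..d}. {-K..K})"
  \<comment> \<open>\<open>R\<close> contains the coordinate functions, since a coordinate of
    \<open>\<tau> K z\<close> is a sine. They separate the points of \<open>S\<close>, because two
    points of \<open>S\<close> agree outside \<open>{1..d}\<close>.\<close>
  define R where "R = {f. continuous_on S f \<and> (\<lambda>z. of_real (f (\<tau> K z))) \<in> trig_poly d}"
  have "function_ring_on R S"
  proof
    \<comment> \<open>The topology on \<open>nat \<Rightarrow> real\<close> is the product over all
      indices. With one-point factors outside \<open>{1..d}\<close>, \<open>S\<close> becomes a full
      product of compact sets and Tychonoff applies.\<close>
    have "S = (\<Pi>\<^sub>E i\<in>UNIV. if i \<in> {1..d} then {-K..K} else {undefined})"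
      unfolding S_def by (rule set_eqI) (simp only: PiE_iff extensional_def mem_Collect_eq, auto split: if_splits)
    moreover have "compactin (product_topology (\<lambda>_. euclideanreal) UNIV)
        (\<Pi>\<^sub>E i\<in>UNIV. if i \<in> {1..d} then {-K..K} else {undefined})"
      unfolding compactin_PiE by auto
    ultimately show "compact S"
      by (simp add: euclidean_product_topology)
    fix x y assume "x \<in> S" "y \<in> S" "x \<noteq> y"
    then obtain i where i: "i \<in> {1..d}" "x i \<noteq> y i"
      unfolding S_def by (meson PiE_ext)
    have "(\<lambda>z. of_real K * of_real (sin (1 / K * z i))) \<in> trig_poly d"
      using i(1) by (intro trig_poly_mult trig_poly_const trig_poly_sin)
    then have "(\<lambda>z. of_real (\<tau> K z i)) \<in> trig_poly d"
      using i(1) by (simp add: \<tau>_def)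
    then have "(\<lambda>x. x i) \<in> R"
      by (auto simp: R_def intro: continuous_on_subset[OF continuous_on_product_coordinates])
    with i(2) show "\<exists>f\<in>R. f x \<noteq> f y" by (intro bexI[of _ "\<lambda>x. x i"])
  next
    fix f f' assume "f \<in> R" "f' \<in> R"
    then show "(\<lambda>x. f x + f' x) \<in> R" "(\<lambda>x. f x * f' x) \<in> R"
      using trig_poly.add[of "\<lambda>z. of_real (f (\<tau> K z))" d "\<lambda>z. of_real (f' (\<tau> K z))"]
        trig_poly_mult[of "\<lambda>z. of_real (f (\<tau> K z))" d "\<lambda>z. of_real (f' (\<tau> K z))"]
      by (simp_all add: R_def continuous_on_add continuous_on_mult)
  qed (simp_all add: R_def trig_poly_const)
  moreover have "continuous_on S g"
    unfolding continuous_on_def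
  proof
    fix x assume "x \<in> S"
    have coord: "((\<lambda>z. z i) \<longlongrightarrow> x i) (at x within S)" for i
    proof -
      have "continuous_on UNIV (\<lambda>z::nat \<Rightarrow> real. z i)"
        by (rule continuous_on_product_coordinates)
      then show ?thesis
        unfolding continuous_on_def by (blast intro: tendsto_within_subset)
    qed
    have "((\<lambda>z. C * (\<Sum>i=1..d. \<bar>z i - x i\<bar>)) \<longlongrightarrow> C * (\<Sum>i=1..d. \<bar>x i - x i\<bar>)) (at x within S)"
      by (intro tendsto_intros coord)
    then have lim0: "((\<lambda>z. C * (\<Sum>i=1..d. \<bar>z i - x i\<bar>)) \<longlongrightarrow> 0) (at x within S)"
      by simp
    have "((\<lambda>z. g z - g x) \<longlongrightarrow> 0) (at x within S)"
    proof (rule Lim_null_comparison[OF _ lim0])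
      show "\<forall>\<^sub>F z in at x within S. norm (g z - g x) \<le> C * (\<Sum>i=1..d. \<bar>z i - x i\<bar>)"
        unfolding real_norm_def by (intro always_eventually allI lip)
    qed
    then show "(g \<longlongrightarrow> g x) (at x within S)"
      by (rule LIM_zero_cancel)
  qed
  ultimately obtain T where T: "T \<in> R" "\<And>x. x \<in> S \<Longrightarrow> \<bar>g x - T x\<bar> < e / 5"
    using function_ring_on.Stone_Weierstrass_basic[of R S g "e / 5"] e by auto
  have T_poly: "(\<lambda>z. of_real (T (\<tau> K z))) \<in> trig_poly d"
    using T(1) by (simp add: R_def)
  have \<tau>_S: "\<tau> K z \<in> S" for z
  proof -
    have "K * -1 \<le> K * sin u" "K * sin u \<le> K * 1" for u
      using K by (intro mult_left_mono; simp)+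
    then show ?thesis by (simp add: S_def \<tau>_def)
  qed
  have T_int: "integrable N (\<lambda>z. T (\<tau> K z))" if "prob_space N" "sets N = sets (Rd d)" for N
    using integrable_trig_poly[OF that T_poly] by (simp add: complex_of_real_integrable_eq)
  have T_near: "\<bar>(\<integral>z. g (\<tau> K z) \<partial>N) - (\<integral>z. T (\<tau> K z) \<partial>N)\<bar> \<le> e / 5"
    if N: "prob_space N" "sets N = sets (Rd d)" for N
  proof -
    interpret N: prob_space N by fact
    have "\<bar>(\<integral>z. g (\<tau> K z) \<partial>N) - (\<integral>z. T (\<tau> K z) \<partial>N)\<bar> = \<bar>\<integral>z. g (\<tau> K z) - T (\<tau> K z) \<partial>N\<bar>"
      using g_int[OF N] T_int[OF N] by simp
    also have "\<dots> \<le> (\<integral>z. e / 5 \<partial>N)"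
      using g_int[OF N] T_int[OF N] T(2)[OF \<tau>_S]
      by (intro order_trans[OF integral_abs_bound integral_mono]) (auto intro: less_imp_le)
    finally show ?thesis by (simp add: N.prob_space)
  qed
  have "(\<lambda>n. \<integral>z. complex_of_real (T (\<tau> K z)) \<partial>\<mu> n) \<longlonglongrightarrow> (\<integral>z. complex_of_real (T (\<tau> K z)) \<partial>\<nu>)"
    using \<mu> \<nu> lim T_poly by (rule tendsto_integral_trig_poly)
  then have "(\<lambda>n. \<integral>z. T (\<tau> K z) \<partial>\<mu> n) \<longlonglongrightarrow> (\<integral>z. T (\<tau> K z) \<partial>\<nu>)"
    by (simp add: tendsto_of_real_iff)
  then have "\<forall>\<^sub>F n in sequentially. dist (\<integral>z. T (\<tau> K z) \<partial>\<mu> n) (\<integral>z. T (\<tau> K z) \<partial>\<nu>) < e / 5"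
    using e by (intro tendstoD) auto
  then show "\<forall>\<^sub>F n in sequentially. dist (\<integral>z. g z \<partial>\<mu> n) (\<integral>z. g z \<partial>\<nu>) < e"
  proof eventually_elim
    case (elim n)
    then show ?case
      using \<mu>_near[of n] T_near[OF \<mu>, of n] T_near[OF \<nu>] m(1)
      unfolding dist_real_def K_def by arith
  qed
qed

section \<open>Independent real variables\<close>

text \<open>Serves the shift by \<open>Suc\<close>: the weights are indexed from 1, the central
  limit theorem from 0.\<close>

lemma (in prob_space) indep_vars_reindex:
  assumes indep: "indep_vars N X (f ` I)" and inj: "inj_on f I"
  shows "indep_vars (\<lambda>i. N (f i)) (\<lambda>i. X (f i)) I"
  unfolding indep_vars_def2
proof (intro conjI ballI)
  show "random_variable (N (f i)) (X (f i))" if "i \<in> I" for i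
    using indep that unfolding indep_vars_def2 by blast
  let ?F = "\<lambda>k. {X k -` A \<inter> space M |A. A \<in> sets (N k)}"
  have F: "indep_sets ?F (f ` I)"
    using indep unfolding indep_vars_def2 by blast
  show "indep_sets (\<lambda>i. ?F (f i)) I"
    unfolding indep_sets_def
  proof (intro conjI ballI allI impI)
    show "?F (f i) \<subseteq> events" if "i \<in> I" for i
      using F that unfolding indep_sets_def by blast
    fix J A assume J: "J \<subseteq> I" "J \<noteq> {}" "finite J" and A: "A \<in> (\<Pi> j\<in>J. ?F (f j))"
    have injJ: "inj_on f J" using inj J(1) by (rule inj_on_subset)
    \<comment> \<open>The chosen events are carried to the image index set, where independence is
      known. Injectivity makes this well defined and keeps the product over indices
      unchanged.\<close>
    let ?A = "\<lambda>k. A (the_inv_into J f k)"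
    have A_f: "?A (f j) = A j" if "j \<in> J" for j
      using injJ that by (simp add: the_inv_into_f_f)
    have "?A \<in> (\<Pi> k\<in>f ` J. ?F k)"
    proof (rule Pi_I)
      fix k assume "k \<in> f ` J"
      then obtain j where "j \<in> J" "k = f j" by blast
      moreover have "A j \<in> ?F (f j)" using A \<open>j \<in> J\<close> by (rule Pi_mem)
      ultimately show "?A k \<in> ?F k" using A_f by simp
    qed
    then have "prob (\<Inter>k\<in>f ` J. ?A k) = (\<Prod>k\<in>f ` J. prob (?A k))"
      using J by (intro indep_setsD[OF F]) auto
    then show "prob (\<Inter>j\<in>J. A j) = (\<Prod>j\<in>J. prob (A j))"
      using A_f injJ by (simp add: prod.reindex)
  qed
qed

text \<open>In the induction, the new summand is independent of the sum of the others and centered,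
  so the mixed term has expectation 0. Integrability is carried along because the next step consumes
  it.\<close>

lemma (in prob_space) expectation_sum_square:
  fixes X :: "'i \<Rightarrow> 'a \<Rightarrow> real"
  assumes "finite J" "indep_vars (\<lambda>_. borel) X J"
    and "\<And>j. j \<in> J \<Longrightarrow> integrable M (\<lambda>\<omega>. (X j \<omega>)\<^sup>2)" "\<And>j. j \<in> J \<Longrightarrow> expectation (X j) = 0"
  shows "integrable M (\<lambda>\<omega>. (\<Sum>j\<in>J. X j \<omega>)\<^sup>2) \<and>
    expectation (\<lambda>\<omega>. (\<Sum>j\<in>J. X j \<omega>)\<^sup>2) = (\<Sum>j\<in>J. expectation (\<lambda>\<omega>. (X j \<omega>)\<^sup>2))"
  using assms
proof (induction J rule: finite_induct)
  case (insert i J)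
  have rv: "random_variable borel (X j)" if "j \<in> insert i J" for j
    using insert.prems(1) that unfolding indep_vars_def2 by blast
  have X_int: "integrable M (X j)" if "j \<in> insert i J" for j
    using rv[OF that] insert.prems(2)[OF that] by (rule square_integrable_imp_integrable)
  let ?S = "\<lambda>\<omega>. \<Sum>j\<in>J. X j \<omega>"
  have ind: "indep_var borel (X i) borel ?S"
    using insert by (intro indep_vars_sum)
  have S_int: "integrable M ?S"
    using X_int by (intro Bochner_Integration.integrable_sum) auto
  have IH: "integrable M (\<lambda>\<omega>. (?S \<omega>)\<^sup>2)" "expectation (\<lambda>\<omega>. (?S \<omega>)\<^sup>2) = (\<Sum>j\<in>J. expectation (\<lambda>\<omega>. (X j \<omega>)\<^sup>2))"
    using insert.IH[OF indep_vars_subset[OF insert.prems(1)]] insert.prems by auto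
  have cross: "integrable M (\<lambda>\<omega>. X i \<omega> * ?S \<omega>)" "expectation (\<lambda>\<omega>. X i \<omega> * ?S \<omega>) = 0"
    using indep_var_integrable[OF ind] indep_var_lebesgue_integral[OF ind] X_int S_int insert.prems(3)
    by auto
  have "(\<Sum>j\<in>insert i J. X j \<omega>)\<^sup>2 = (X i \<omega>)\<^sup>2 + 2 * (X i \<omega> * ?S \<omega>) + (?S \<omega>)\<^sup>2" for \<omega>
    using insert.hyps by (simp add: power2_sum)
  then show ?case
    using insert.hyps IH cross insert.prems(2) by (simp add: prob_space)
qed simp

lemma (in prob_space) strong_law_bounded:
  fixes X :: "nat \<Rightarrow> 'a \<Rightarrow> real"
  assumes indep: "indep_vars (\<lambda>_. borel) X {1..}"
    and distr: "\<And>n. n \<ge> 1 \<Longrightarrow> distr M borel (X n) = distr M borel (X 1)"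
    and bounded: "AE \<omega> in M. X 1 \<omega> \<in> {a..b}"
  shows "AE \<omega> in M. (\<lambda>n. (\<Sum>j=1..n. X j \<omega>) / real n) \<longlonglongrightarrow> expectation (X 1)"
proof -
  have rv: "random_variable borel (X n)" if "n \<ge> 1" for n
    using indep that unfolding indep_vars_def2 by auto
  have [measurable]: "(\<lambda>\<omega>. \<Sum>j=1..n. X j \<omega>) \<in> borel_measurable M" for n
    using rv by (intro borel_measurable_sum) auto
  have "a \<le> b"
  proof (rule ccontr)
    assume "\<not> a \<le> b"
    then show False using bounded by simp
  qed
  let ?bad = "\<lambda>e n. {\<omega> \<in> space M. \<bar>(\<Sum>j=1..n. X j \<omega>) / real n - expectation (X 1)\<bar> \<ge> e}"
  have close: "AE \<omega> in M. \<forall>\<^sub>F n in sequentially. \<bar>(\<Sum>j=1..n. X j \<omega>) / real n - expectation (X 1)\<bar> < e"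
    if e: "e > 0" for e :: real
  proof -
    \<comment> \<open>The Hoeffding exponent per variable for the interval
      \<open>{a..b + 1}\<close>. Enlarging the interval by 1 keeps its length positive when
      \<open>a = b\<close>; any positive \<open>c\<close> makes the bound a convergent geometric
      series.\<close>
    define c where "c = 2 * e\<^sup>2 / (b + 1 - a)\<^sup>2"
    have c: "c > 0" using e \<open>a \<le> b\<close> by (simp add: c_def)
    have "prob (?bad e n) \<le> 2 * exp (- c) ^ n" if "n \<ge> 1" for n
    proof -
      have "Hoeffding_ineq_iid M {1..n} X (X 1) a (b + 1)"
      proof unfold_locales
        show "indep_vars (\<lambda>_. borel) X {1..n}"
          using indep by (rule indep_vars_subset) auto
        show "AE \<omega> in M. X 1 \<omega> \<in> {a..b + 1}"
          by (rule eventually_mono[OF bounded]) simp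
        show "distr M borel (X i) = distr M borel (X 1)" if "i \<in> {1..n}" for i
          using that by (intro distr) simp
        show "random_variable borel (X 1)"
          by (rule rv) simp
      qed simp
      then have "prob (?bad e n) \<le> 2 * exp (- 2 * n * e\<^sup>2 / (b + 1 - a)\<^sup>2)"
        using Hoeffding_ineq_iid.Hoeffding_ineq_abs_ge'[of M "{1..n}" X "X 1" a "b + 1" e] e \<open>a \<le> b\<close> that by simp
      also have "- 2 * n * e\<^sup>2 / (b + 1 - a)\<^sup>2 = real n * (- c)"
        by (simp add: c_def)
      finally show ?thesis by (simp only: exp_of_nat_mult)
    qed
    then have "norm (prob (?bad e n)) \<le> 2 * exp (- c) ^ n" if "n \<ge> 1" for n
      using that by (simp only: real_norm_def abs_of_nonneg[OF measure_nonneg])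
    moreover have "summable (\<lambda>n. 2 * exp (- c) ^ n)"
      using c by (intro summable_mult summable_geometric) simp
    ultimately have summable: "summable (\<lambda>n. prob (?bad e n))"
      by (rule summable_comparison_test'[rotated])
    have "AE \<omega> in M. \<forall>\<^sub>F n in sequentially. \<omega> \<in> space M - ?bad e n"
    proof (rule borel_cantelli_AE1[OF _ _ summable])
      show "?bad e n \<in> sets M" for n by measurable
    qed (simp add: less_top[symmetric])
    then show ?thesis
      by eventually_elim (auto elim!: eventually_mono)
  qed
  \<comment> \<open>The null set found so far depends on \<open>e\<close>; countably many values of
    \<open>e\<close> give one null set for all.\<close>
  have "AE \<omega> in M. \<forall>m. \<forall>\<^sub>F n in sequentially.
      \<bar>(\<Sum>j=1..n. X j \<omega>) / real n - expectation (X 1)\<bar> < inverse (real (Suc m))"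
    unfolding AE_all_countable using close by simp
  then show ?thesis
  proof eventually_elim
    case (elim \<omega>)
    show ?case
    proof (rule tendstoI)
      fix e :: real assume "e > 0"
      then obtain m where "inverse (real (Suc m)) < e"
        using reals_Archimedean by blast
      then show "\<forall>\<^sub>F n in sequentially. dist ((\<Sum>j=1..n. X j \<omega>) / real n) (expectation (X 1)) < e"
        using elim[rule_format, of m] by (auto simp: dist_real_def elim!: eventually_mono)
    qed
  qed
qed

text \<open>For \<open>\<sigma> > 0\<close>, evaluating the characteristic function of the
  standardized sum at \<open>\<sigma>\<close> undoes the division by \<open>\<sigma>\<close>. For
  \<open>\<sigma> = 0\<close> all \<open>X n\<close> vanish almost surely and both sides are
  1.\<close>

lemma (in prob_space) central_limit_char:
  fixes X :: "nat \<Rightarrow> 'a \<Rightarrow> real"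
  assumes indep: "indep_vars (\<lambda>_. borel) X {1..}"
    and distr: "\<And>n. n \<ge> 1 \<Longrightarrow> distr M borel (X n) = distr M borel (X 1)"
    and int: "integrable M (\<lambda>\<omega>. (X 1 \<omega>)\<^sup>2)" and mean: "expectation (X 1) = 0"
  shows "(\<lambda>n. \<integral>\<omega>. iexp ((\<Sum>j=1..n. X j \<omega>) / sqrt n) \<partial>M) \<longlonglongrightarrow>
    exp (- of_real (expectation (\<lambda>\<omega>. (X 1 \<omega>)\<^sup>2) / 2))"
proof -
  have rv: "random_variable borel (X n)" if "n \<ge> 1" for n
    using indep that unfolding indep_vars_def2 by auto
  have [measurable]: "(\<lambda>\<omega>. \<Sum>j=1..n. X j \<omega>) \<in> borel_measurable M" for n
    using rv by (intro borel_measurable_sum) auto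
  have transfer: "integrable M (\<lambda>\<omega>. h (X n \<omega>)) \<longleftrightarrow> integrable M (\<lambda>\<omega>. h (X 1 \<omega>))"
      "expectation (\<lambda>\<omega>. h (X n \<omega>)) = expectation (\<lambda>\<omega>. h (X 1 \<omega>))"
    if "n \<ge> 1" "h \<in> borel_measurable borel" for n and h :: "real \<Rightarrow> real"
    using integrable_distr_eq[OF rv[OF that(1)] that(2)] integrable_distr_eq[OF rv[of 1] that(2)]
      integral_distr[OF rv[OF that(1)] that(2)] integral_distr[OF rv[of 1] that(2)] distr[OF that(1)]
    by auto
  define \<sigma> where "\<sigma> = sqrt (expectation (\<lambda>\<omega>. (X 1 \<omega>)\<^sup>2))"
  have \<sigma>2: "\<sigma>\<^sup>2 = expectation (\<lambda>\<omega>. (X 1 \<omega>)\<^sup>2)"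
    by (simp add: \<sigma>_def)
  show ?thesis
  proof (cases "\<sigma> = 0")
    case True
    have "AE \<omega> in M. (X n \<omega>)\<^sup>2 = 0" if "n \<ge> 1" for n
      using integral_nonneg_eq_0_iff_AE[of M "\<lambda>\<omega>. (X n \<omega>)\<^sup>2"] transfer[OF that, of "\<lambda>x. x\<^sup>2"] int True \<sigma>2
      by simp
    then have "AE \<omega> in M. \<forall>n\<in>{1..}. X n \<omega> = 0"
      by (subst AE_ball_countable) auto
    then have "(\<integral>\<omega>. iexp ((\<Sum>j=1..n. X j \<omega>) / sqrt n) \<partial>M) = (\<integral>\<omega>. 1 \<partial>M)" for n
      by (intro integral_cong_AE) (measurable, auto)
    then show ?thesis
      using True \<sigma>2 by (simp add: prob_space)
  next
    case False
    then have \<sigma>: "\<sigma> > 0"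
      by (simp add: \<sigma>_def order_less_le)
    have "weak_conv_m (\<lambda>n. distr M borel (\<lambda>\<omega>. (\<Sum>i<n. X (Suc i) \<omega>) / sqrt (real n * \<sigma>\<^sup>2))) std_normal_distribution"
    proof (rule central_limit_theorem_zero_mean)
      have "Suc ` UNIV = {1..}"
        by (auto simp: image_iff Suc_le_eq gr0_conv_Suc)
      then show "indep_vars (\<lambda>_. borel) (\<lambda>i. X (Suc i)) UNIV"
        using indep_vars_reindex[of "\<lambda>_. borel" X Suc UNIV] indep by simp
      show "expectation (X (Suc n)) = 0" for n
        using transfer(2)[of "Suc n" "\<lambda>x. x"] mean by simp
      then show "variance (X (Suc n)) = \<sigma>\<^sup>2" for n
        using transfer(2)[of "Suc n" "\<lambda>x. x\<^sup>2"] \<sigma>2 by simp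
      show "integrable M (\<lambda>\<omega>. (X (Suc n) \<omega>)\<^sup>2)" for n
        using transfer(1)[of "Suc n" "\<lambda>x. x\<^sup>2"] int by simp
      show "distr M borel (X (Suc n)) = distr M borel (X 1)" for n
        by (rule distr) simp
    qed fact
    moreover have eq: "(\<Sum>i<n. X (Suc i) \<omega>) = (\<Sum>j=1..n. X j \<omega>)" for n \<omega>
      using sum.atLeast1_atMost_eq[of "\<lambda>j. X j \<omega>" n] by simp
    ultimately have "(\<lambda>n. char (distr M borel (\<lambda>\<omega>. (\<Sum>j=1..n. X j \<omega>) / sqrt (real n * \<sigma>\<^sup>2))) \<sigma>)
        \<longlonglongrightarrow> char std_normal_distribution \<sigma>"
      by (intro levy_continuity1 real_distribution_distr real_dist_normal_dist)
        (auto simp del: One_nat_def)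
    moreover have "char (distr M borel (\<lambda>\<omega>. (\<Sum>j=1..n. X j \<omega>) / sqrt (real n * \<sigma>\<^sup>2))) \<sigma> =
        (\<integral>\<omega>. iexp ((\<Sum>j=1..n. X j \<omega>) / sqrt n) \<partial>M)" for n
    proof -
      have "\<sigma> * ((\<Sum>j=1..n. X j \<omega>) / sqrt (real n * \<sigma>\<^sup>2)) = (\<Sum>j=1..n. X j \<omega>) / sqrt n" for \<omega>
        using \<sigma> by (simp add: real_sqrt_mult)
      then show ?thesis
        unfolding char_def by (subst integral_distr) (simp_all del: One_nat_def)
    qed
    ultimately have "(\<lambda>n. \<integral>\<omega>. iexp ((\<Sum>j=1..n. X j \<omega>) / sqrt n) \<partial>M) \<longlonglongrightarrow> char std_normal_distribution \<sigma>"
      by (simp only:)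
    moreover have "char std_normal_distribution \<sigma> = exp (- of_real (expectation (\<lambda>\<omega>. (X 1 \<omega>)\<^sup>2) / 2))"
      unfolding \<sigma>2[symmetric] by (simp add: char_std_normal_distribution flip: exp_of_real)
    ultimately show ?thesis
      by (simp only:)
  qed
qed

section \<open>Weighted means as elements of the space of continuous functions\<close>

lemma topspace_cube [simp]: "topspace (cube_topology p I) = cube p I"
  by simp

lemma compactin_cube:
  assumes "compact I"
  shows "compactin (cube_topology p I) (cube p I)"
proof -
  have "compact_space (cube_topology p I)"
    using assms by (simp add: compact_space_product_topology compact_space_subtopology)
  then show ?thesis by (simp add: compact_space_def)
qed

lemma mspace_CI:
  assumes "compact I"
  shows "f \<in> mspace (CI p I) \<longleftrightarrow>
    f \<in> extensional (cube p I) \<and> continuous_map (cube_topology p I) euclideanreal f"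
proof -
  have "bounded (f ` cube p I)" if "continuous_map (cube_topology p I) euclideanreal f"
  proof -
    have "compactin euclideanreal (f ` cube p I)"
      using compactin_cube[OF assms] that by (rule image_compactin)
    then show ?thesis
      by (simp add: compact_imp_bounded)
  qed
  then show ?thesis
    by (auto simp: CI_def)
qed

lemma mdist_CI_le:
  assumes "0 \<le> B" "\<And>x. x \<in> cube p I \<Longrightarrow> \<bar>f x - g x\<bar> \<le> B"
  shows "mdist (CI p I) f g \<le> B"
  unfolding CI_def by (rule mdist_cfunspace_le) (use assms in \<open>auto simp: dist_real_def\<close>)

lemma abs_diff_le_mdist_CI:
  assumes "f \<in> mspace (CI p I)" "g \<in> mspace (CI p I)" "x \<in> cube p I"
  shows "\<bar>f x - g x\<bar> \<le> mdist (CI p I) f g"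
  using mdist_cfunspace_imp_mdist_le[of f "cube_topology p I" euclidean_metric g "mdist (CI p I) f g" x] assms
  by (simp add: CI_def dist_real_def)

lemma continuous_map_cube_component:
  assumes "i \<in> {1..p}"
  shows "continuous_map (cube_topology p I) euclideanreal (\<lambda>x. x i)"
  using continuous_map_product_projection[OF assms, of "\<lambda>_. top_of_set I"]
  by (rule continuous_map_into_fulltopology)

text \<open>The inner product under the limiting supremum. It is linear in \<open>z\<close>, so
  averaging and centering the means amounts to averaging and centering the weights.\<close>

definition difference_form :: "nat \<Rightarrow> (nat \<Rightarrow> real) \<Rightarrow> (nat \<Rightarrow> real) \<Rightarrow> real" where
  "difference_form p z x = (\<Sum>i=1..p-1. z i * (x i - x p))"

text \<open>Defined for every \<open>y\<close>, also where the result leaves the range of a mean, so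
  that it is a continuous map on the whole weight space.\<close>

definition weighted_mean :: "nat \<Rightarrow> real set \<Rightarrow> (nat \<Rightarrow> real) \<Rightarrow> (nat \<Rightarrow> real) \<Rightarrow> real" where
  "weighted_mean p I y = (\<lambda>x\<in>cube p I. (\<Sum>i=1..p-1. y i * x i) + (1 - (\<Sum>i=1..p-1. y i)) * x p)"

lemma weighted_mean_apply:
  "x \<in> cube p I \<Longrightarrow> weighted_mean p I y x = x p + difference_form p y x"
  by (simp add: weighted_mean_def difference_form_def algebra_simps sum_subtractf sum_distrib_left)

lemma difference_form_diff:
  "difference_form p z x - difference_form p w x = difference_form p (\<lambda>i. z i - w i) x"
  by (simp add: difference_form_def left_diff_distrib sum_subtractf)

lemma abs_difference_form_le:
  assumes "x \<in> cube p {a..b}" "p \<ge> 2"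
  shows "\<bar>difference_form p z x\<bar> \<le> (b - a) * (\<Sum>i=1..p-1. \<bar>z i\<bar>)"
proof -
  have "\<bar>x i - x p\<bar> \<le> b - a" if "i \<in> {1..p-1}" for i
  proof -
    have "x i \<in> {a..b}" "x p \<in> {a..b}"
      using assms that by (auto simp: PiE_iff)
    then show ?thesis by auto
  qed
  then have "\<bar>z i * (x i - x p)\<bar> \<le> (b - a) * \<bar>z i\<bar>" if "i \<in> {1..p-1}" for i
    using that by (simp add: abs_mult mult.commute mult_left_mono)
  then have "\<bar>difference_form p z x\<bar> \<le> (\<Sum>i=1..p-1. (b - a) * \<bar>z i\<bar>)"
    unfolding difference_form_def by (intro order_trans[OF sum_abs sum_mono])
  then show ?thesis by (simp add: sum_distrib_left)
qed

lemma continuous_map_difference_form: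
  assumes "p \<ge> 2"
  shows "continuous_map (cube_topology p I) euclideanreal (difference_form p z)"
  unfolding difference_form_def[abs_def]
  by (intro continuous_map_sum continuous_map_real_mult continuous_map_diff
      continuous_map_cube_component) (use assms in auto)

lemma weighted_mean_in_mspace:
  assumes "p \<ge> 2" "compact I"
  shows "weighted_mean p I y \<in> mspace (CI p I)"
proof -
  have "continuous_map (cube_topology p I) euclideanreal (\<lambda>x. x p + difference_form p y x)"
    using assms(1) by (intro continuous_map_add continuous_map_cube_component continuous_map_difference_form) auto
  then have "continuous_map (cube_topology p I) euclideanreal (weighted_mean p I y)"
    by (rule continuous_map_eq) (simp add: weighted_mean_apply)
  then show ?thesis
    using assms(2) by (simp add: mspace_CI weighted_mean_def)
qed

text \<open>This Lipschitz estimate yields both the Borel measurability of the random mean and the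
  uniform error of its simple approximations.\<close>

lemma mdist_weighted_mean_le:
  assumes "p \<ge> 2" "a \<le> b"
  shows "mdist (CI p {a..b}) (weighted_mean p {a..b} y) (weighted_mean p {a..b} z)
    \<le> (b - a) * (\<Sum>i=1..p-1. \<bar>y i - z i\<bar>)"
proof (rule mdist_CI_le)
  show "\<bar>weighted_mean p {a..b} y x - weighted_mean p {a..b} z x\<bar> \<le> (b - a) * (\<Sum>i=1..p-1. \<bar>y i - z i\<bar>)"
    if "x \<in> cube p {a..b}" for x
    using abs_difference_form_le[OF that assms(1), of "\<lambda>i. y i - z i"] that
    by (simp add: weighted_mean_apply difference_form_diff)
qed (use assms(2) in \<open>auto intro!: mult_nonneg_nonneg sum_nonneg\<close>)

text \<open>The map is continuous into the metric topology, and the product sigma-algebra on the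
  weight space is its Borel sigma-algebra; hence preimages of open sets are measurable.\<close>

lemma weighted_mean_measurable:
  assumes "p \<ge> 2" "a \<le> b"
  shows "weighted_mean p {a..b} \<in> Rd (p - 1) \<rightarrow>\<^sub>M borel_of (mtopology_of (CI p {a..b}))"
proof (rule measurable_sigma_sets[OF sets_borel_of])
  let ?T = "product_topology (\<lambda>_. euclideanreal) {1..p-1}"
  interpret CI: Metric_space "mspace (CI p {a..b})" "mdist (CI p {a..b})"
    by (rule Metric_space_mspace_mdist)
  have "continuous_map ?T CI.mtopology (weighted_mean p {a..b})"
    unfolding CI.continuous_map_to_metric
  proof (intro ballI allI impI)
    fix y and e :: real assume y: "y \<in> topspace ?T" and e: "e > 0"
    let ?f = "\<lambda>z. (b - a) * (\<Sum>i=1..p-1. \<bar>y i - z i\<bar>)"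
    let ?U = "{z \<in> topspace ?T. ?f z \<in> {..<e}}"
    have "continuous_map ?T euclideanreal ?f"
      by (intro continuous_map_real_mult continuous_map_sum continuous_map_real_abs continuous_map_diff
          continuous_map_product_projection) auto
    then have "openin ?T ?U"
      by (rule openin_continuous_map_preimage) auto
    moreover have "weighted_mean p {a..b} z \<in> CI.mball (weighted_mean p {a..b} y) e" if "z \<in> ?U" for z
      using that mdist_weighted_mean_le[OF assms, of y z] weighted_mean_in_mspace[OF assms(1)]
      by (auto simp: CI.in_mball)
    ultimately show "\<exists>U. openin ?T U \<and> y \<in> U \<and>
        (\<forall>z\<in>U. weighted_mean p {a..b} z \<in> CI.mball (weighted_mean p {a..b} y) e)"
      using y e by (intro exI[of _ ?U]) auto
  qed
  then have cont: "continuous_map ?T (mtopology_of (CI p {a..b})) (weighted_mean p {a..b})"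
    by (simp add: mtopology_of_def)
  have space: "space (Rd (p - 1)) = topspace ?T"
    by (simp add: space_PiM)
  show "weighted_mean p {a..b} \<in> space (Rd (p - 1)) \<rightarrow> topspace (mtopology_of (CI p {a..b}))"
    using cont unfolding space by (rule continuous_map_funspace)
  show "weighted_mean p {a..b} -` U \<inter> space (Rd (p - 1)) \<in> sets (Rd (p - 1))"
    if "U \<in> {U. openin (mtopology_of (CI p {a..b})) U}" for U
  proof -
    have "openin ?T {z \<in> topspace ?T. weighted_mean p {a..b} z \<in> U}"
      using that by (intro openin_continuous_map_preimage[OF cont]) auto
    then have "{z \<in> topspace ?T. weighted_mean p {a..b} z \<in> U} \<in> sets (Rd (p - 1))"
      unfolding sets_Rd sets_borel_of by (intro sigma_sets.Basic) simp
    then show ?thesis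
      unfolding space by (simp add: vimage_def Int_def conj_commute)
  qed
  show "{U. openin (mtopology_of (CI p {a..b})) U} \<subseteq> Pow (topspace (mtopology_of (CI p {a..b})))"
    by (intro subsetI PowI) (blast dest: openin_subset)
qed

lemma weighted_mean_in_means:
  assumes "p \<ge> 2" "compact I" and nonneg: "\<And>i. i \<in> {1..p-1} \<Longrightarrow> 0 \<le> y i" and le1: "(\<Sum>i=1..p-1. y i) \<le> 1"
  shows "weighted_mean p I y \<in> means p I"
proof -
  have "Min (x ` {1..p}) \<le> weighted_mean p I y x \<and> weighted_mean p I y x \<le> Max (x ` {1..p})"
    if x: "x \<in> cube p I" for x
  proof
    let ?m = "Min (x ` {1..p})" and ?M = "Max (x ` {1..p})"
    have bounds: "?m \<le> x i" "x i \<le> ?M" if "i \<in> {1..p}" for i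
      using that by simp_all
    have "(\<Sum>i=1..p-1. y i * ?m) \<le> (\<Sum>i=1..p-1. y i * x i)"
      by (intro sum_mono mult_left_mono bounds nonneg) auto
    moreover have "(1 - (\<Sum>i=1..p-1. y i)) * ?m \<le> (1 - (\<Sum>i=1..p-1. y i)) * x p"
      using le1 assms(1) by (intro mult_left_mono bounds) auto
    moreover have "(\<Sum>i=1..p-1. y i * ?m) + (1 - (\<Sum>i=1..p-1. y i)) * ?m = ?m"
      unfolding sum_distrib_right[symmetric] by (simp add: algebra_simps)
    ultimately show "?m \<le> weighted_mean p I y x"
      using x by (simp only: weighted_mean_def restrict_apply if_True)
    have "(\<Sum>i=1..p-1. y i * x i) \<le> (\<Sum>i=1..p-1. y i * ?M)"
      by (intro sum_mono mult_left_mono bounds nonneg) auto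
    moreover have "(1 - (\<Sum>i=1..p-1. y i)) * x p \<le> (1 - (\<Sum>i=1..p-1. y i)) * ?M"
      using le1 assms(1) by (intro mult_left_mono bounds) auto
    moreover have "(\<Sum>i=1..p-1. y i * ?M) + (1 - (\<Sum>i=1..p-1. y i)) * ?M = ?M"
      unfolding sum_distrib_right[symmetric] by (simp add: algebra_simps)
    ultimately show "weighted_mean p I y x \<le> ?M"
      using x by (simp only: weighted_mean_def restrict_apply if_True)
  qed
  with weighted_mean_in_mspace[OF assms(1,2)] show ?thesis
    by (simp add: means_def)
qed

lemma means_in_interval:
  assumes "m \<in> means p {a..b}" "x \<in> cube p {a..b}" "p \<ge> 1"
  shows "m x \<in> {a..b}"
proof -
  have "x i \<in> {a..b}" if "i \<in> {1..p}" for i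
    using assms(2) that by (auto simp: PiE_iff)
  then have "a \<le> Min (x ` {1..p})" "Max (x ` {1..p}) \<le> b"
    using assms(3) by auto
  moreover have "Min (x ` {1..p}) \<le> m x" "m x \<le> Max (x ` {1..p})"
    using assms(1,2) by (simp_all add: means_def)
  ultimately show ?thesis by simp
qed

lemma continuous_map_cube_measurable:
  fixes f :: "(nat \<Rightarrow> real) \<Rightarrow> real"
  assumes "continuous_map (cube_topology p I) euclideanreal f"
  shows "f \<in> borel_measurable (cube_borel p I)"
proof (rule borel_measurableI)
  fix U :: "real set" assume "open U"
  then have "openin (cube_topology p I) {x \<in> topspace (cube_topology p I). f x \<in> U}"
    by (intro openin_continuous_map_preimage[OF assms]) auto
  then have "{x \<in> topspace (cube_topology p I). f x \<in> U} \<in> sets (cube_borel p I)"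
    unfolding sets_cube_borel sets_borel_of by (intro sigma_sets.Basic) simp
  moreover have "space (cube_borel p I) = topspace (cube_topology p I)"
    by (simp add: space_PiM space_restrict_space)
  ultimately show "f -` U \<inter> space (cube_borel p I) \<in> sets (cube_borel p I)"
    by (simp add: vimage_def Int_def conj_commute)
qed

lemma random_mean_weighted:
  assumes "prob_space P" "p \<ge> 2" "a \<le> b" and \<xi>: "\<xi> \<in> P \<rightarrow>\<^sub>M Rd (p - 1)"
    and nonneg: "\<And>\<omega> i. \<omega> \<in> space P \<Longrightarrow> i \<in> {1..p-1} \<Longrightarrow> 0 \<le> \<xi> \<omega> i"
    and m0: "m\<^sub>0 \<in> means p {a..b}"
    and M: "\<And>\<omega>. \<omega> \<in> space P \<Longrightarrow>
      M \<omega> = (if (\<Sum>i=1..p-1. \<xi> \<omega> i) \<le> 1 then weighted_mean p {a..b} (\<xi> \<omega>) else m\<^sub>0)"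
  shows "random_mean P p {a..b} (p - 1) \<xi> M"
  unfolding random_mean_def
proof (intro conjI exI)
  let ?I = "{a..b}"
  \<comment> \<open>The generating map must take values in the interval for every \<open>y\<close>,
    not only for values of \<open>\<xi>\<close>. Hence the fallback to \<open>m\<^sub>0\<close> also
    where a coordinate of \<open>y\<close> is negative.\<close>
  let ?good = "\<lambda>y. (\<forall>i\<in>{1..p-1}. 0 \<le> y i) \<and> (\<Sum>i=1..p-1. y i) \<le> 1"
  let ?M = "\<lambda>x y. if ?good y then x p + difference_form p y x else m\<^sub>0 x"
  show "\<xi> \<in> P \<rightarrow>\<^sub>M Rd (p - 1)" by fact
  show "\<forall>\<omega>\<in>space P. M \<omega> \<in> means p ?I"
  proof
    fix \<omega> assume \<omega>: "\<omega> \<in> space P"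
    show "M \<omega> \<in> means p ?I"
    proof (cases "(\<Sum>i=1..p-1. \<xi> \<omega> i) \<le> 1")
      case True
      then have "weighted_mean p ?I (\<xi> \<omega>) \<in> means p ?I"
        using nonneg[OF \<omega>] assms(2) by (intro weighted_mean_in_means) auto
      with True show ?thesis using M[OF \<omega>] by (simp only: if_True)
    next
      case False
      then show ?thesis using M[OF \<omega>] m0 by (simp only: if_False)
    qed
  qed
  have m0_cont: "continuous_map (cube_topology p ?I) euclideanreal m\<^sub>0" and m0_mspace: "m\<^sub>0 \<in> mspace (CI p ?I)"
    using m0 by (auto simp: means_def mspace_CI)
  have "(\<lambda>\<omega>. if (\<Sum>i=1..p-1. \<xi> \<omega> i) \<le> 1 then weighted_mean p ?I (\<xi> \<omega>) else m\<^sub>0)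
      \<in> P \<rightarrow>\<^sub>M borel_of (mtopology_of (CI p ?I))"
  proof (rule measurable_If)
    show "(\<lambda>\<omega>. weighted_mean p ?I (\<xi> \<omega>)) \<in> P \<rightarrow>\<^sub>M borel_of (mtopology_of (CI p ?I))"
      by (rule measurable_compose[OF \<xi> weighted_mean_measurable]) fact+
    show "(\<lambda>_. m\<^sub>0) \<in> P \<rightarrow>\<^sub>M borel_of (mtopology_of (CI p ?I))"
      using m0_mspace by (intro measurable_const) simp
    have "(\<lambda>\<omega>. \<Sum>i=1..p-1. \<xi> \<omega> i) \<in> borel_measurable P"
      by (intro borel_measurable_sum measurable_compose[OF \<xi>] measurable_component_singleton)
    then show "{\<omega> \<in> space P. (\<Sum>i=1..p-1. \<xi> \<omega> i) \<le> 1} \<in> sets P"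
      by measurable
  qed
  then show "M \<in> P \<rightarrow>\<^sub>M borel_of (mtopology_of (CI p ?I))"
    by (rule measurable_cong[THEN iffD1, rotated]) (simp add: M)
  show "(\<lambda>(x, y). ?M x y) \<in> cube_borel p ?I \<Otimes>\<^sub>M Rd (p - 1) \<rightarrow>\<^sub>M restrict_space borel ?I"
  proof (rule measurable_restrict_space2)
    show "(\<lambda>(x, y). ?M x y) \<in> space (cube_borel p ?I \<Otimes>\<^sub>M Rd (p - 1)) \<rightarrow> ?I"
    proof (clarsimp simp only: Pi_iff split_paired_all prod.case space_pair_measure mem_Times_iff fst_conv snd_conv)
      fix x y assume "x \<in> space (cube_borel p ?I)"
      then have x: "x \<in> cube p ?I" by (simp add: space_PiM space_restrict_space)
      show "?M x y \<in> ?I"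
      proof (cases "?good y")
        case True
        then have "weighted_mean p ?I y \<in> means p ?I"
          using assms(2) by (intro weighted_mean_in_means) auto
        from means_in_interval[OF this x] assms(2) x show ?thesis
          using True by (simp add: weighted_mean_apply)
      next
        case False
        with means_in_interval[OF m0 x] assms(2) show ?thesis by auto
      qed
    qed
    have [measurable]: "(\<lambda>v. snd v i) \<in> borel_measurable (cube_borel p ?I \<Otimes>\<^sub>M Rd (p - 1))" if "i \<in> {1..p-1}" for i
      using that by (intro measurable_compose[OF measurable_snd] measurable_component_singleton)
    have [measurable]: "(\<lambda>v. fst v i) \<in> borel_measurable (cube_borel p ?I \<Otimes>\<^sub>M Rd (p - 1))" if "i \<in> {1..p}" for i
      using that by (intro measurable_compose[OF measurable_fst] continuous_map_cube_measurable
          continuous_map_cube_component)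
    have 1: "(\<lambda>v. fst v p + difference_form p (snd v) (fst v)) \<in> borel_measurable (cube_borel p ?I \<Otimes>\<^sub>M Rd (p - 1))"
      unfolding difference_form_def using assms(2)
      by (intro borel_measurable_add borel_measurable_sum borel_measurable_times borel_measurable_diff)
        (auto simp del: One_nat_def)
    have 2: "(\<lambda>v. m\<^sub>0 (fst v)) \<in> borel_measurable (cube_borel p ?I \<Otimes>\<^sub>M Rd (p - 1))"
      by (intro measurable_compose[OF measurable_fst] continuous_map_cube_measurable m0_cont)
    have 3: "{v \<in> space (cube_borel p ?I \<Otimes>\<^sub>M Rd (p - 1)). ?good (snd v)} \<in> sets (cube_borel p ?I \<Otimes>\<^sub>M Rd (p - 1))"
      by measurable
    show "(\<lambda>(x, y). ?M x y) \<in> borel_measurable (cube_borel p ?I \<Otimes>\<^sub>M Rd (p - 1))"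
      using measurable_If[OF 1 2 3] by (simp add: case_prod_beta')
  qed
  show "\<forall>\<omega>\<in>space P. continuous_map (cube_topology p ?I) euclideanreal (\<lambda>x. ?M x (\<xi> \<omega>))"
  proof
    fix \<omega>
    have "continuous_map (cube_topology p ?I) euclideanreal (\<lambda>x. x p + difference_form p (\<xi> \<omega>) x)"
      using assms(2) by (intro continuous_map_add continuous_map_cube_component continuous_map_difference_form) auto
    with m0_cont show "continuous_map (cube_topology p ?I) euclideanreal (\<lambda>x. ?M x (\<xi> \<omega>))"
      by (cases "?good (\<xi> \<omega>)") simp_all
  qed
  \<comment> \<open>The sign condition in \<open>?good\<close> holds at every
    \<open>\<omega>\<close>, so \<open>M\<close> and the generating map agree surely.\<close>
  have "{\<omega> \<in> space P. \<forall>x\<in>cube p ?I. M \<omega> x = ?M x (\<xi> \<omega>)} = space P"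
    using M nonneg by (auto simp: weighted_mean_apply)
  then show "\<P>(\<omega> in P. \<forall>x\<in>cube p ?I. M \<omega> x = ?M x (\<xi> \<omega>)) = 1"
    using prob_space.prob_space[OF assms(1)] by simp
qed

section \<open>Expectation of a random weighted mean\<close>

text \<open>Relative to the midpoint, the form is linear in p free variables of modulus at most
  \<open>(b - a) / 2\<close>, with coefficients \<open>z i\<close> for i < p and minus their sum for
  the last. The supremum is the half-width times the l1 norm of these coefficients.\<close>

lemma SUP_abs_difference_form:
  assumes "a \<le> b" "p \<ge> 2"
  shows "(SUP x\<in>cube p {a..b}. \<bar>difference_form p z x\<bar>)
    = (b - a) / 2 * ((\<Sum>i=1..p-1. \<bar>z i\<bar>) + \<bar>\<Sum>i=1..p-1. z i\<bar>)"
proof (rule cSup_eq_maximum)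
  let ?c = "(a + b) / 2" and ?r = "(b - a) / 2" and ?s = "\<Sum>i=1..p-1. z i"
  have split: "difference_form p z x = (\<Sum>i=1..p-1. z i * (x i - ?c)) - ?s * (x p - ?c)" for x
    unfolding difference_form_def sum_distrib_right sum_subtractf[symmetric]
    by (intro sum.cong refl) (simp add: algebra_simps)
  \<comment> \<open>The maximum is attained at the vertex chosen by the signs of the coefficients.\<close>
  define x where "x = (\<lambda>i\<in>{1..p}. ?c + ?r * (if i = p then - sgn ?s else sgn (z i)))"
  have bnd: "?c + ?r * s \<in> {a..b}" if "-1 \<le> s" "s \<le> 1" for s
  proof -
    have "?r * -1 \<le> ?r * s" "?r * s \<le> ?r * 1"
      using assms(1) that by (intro mult_left_mono; simp)+
    then show ?thesis by (simp add: field_simps)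
  qed
  have "x \<in> cube p {a..b}"
    unfolding x_def by (intro restrict_PiE_iff[THEN iffD2] ballI bnd) (auto simp: sgn_if)
  moreover have "difference_form p z x = ?r * ((\<Sum>i=1..p-1. \<bar>z i\<bar>) + \<bar>?s\<bar>)"
  proof -
    have "(\<Sum>i=1..p-1. z i * (x i - ?c)) = (\<Sum>i=1..p-1. ?r * \<bar>z i\<bar>)"
    proof (rule sum.cong[OF refl])
      fix i assume "i \<in> {1..p-1}"
      then have "i \<in> {1..p}" "i \<noteq> p" using assms(2) by auto
      then show "z i * (x i - ?c) = ?r * \<bar>z i\<bar>"
        by (simp add: x_def abs_sgn mult_ac)
    qed
    moreover have "?s * (x p - ?c) = - (?r * \<bar>?s\<bar>)"
      using assms(2) by (simp add: x_def abs_sgn mult_ac)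
    ultimately show ?thesis
      unfolding split by (simp add: sum_distrib_left distrib_left)
  qed
  moreover have "0 \<le> ?r * ((\<Sum>i=1..p-1. \<bar>z i\<bar>) + \<bar>?s\<bar>)"
    using assms(1) by (intro mult_nonneg_nonneg add_nonneg_nonneg sum_nonneg) auto
  ultimately have x: "x \<in> cube p {a..b}" and max: "?r * ((\<Sum>i=1..p-1. \<bar>z i\<bar>) + \<bar>?s\<bar>) = \<bar>difference_form p z x\<bar>"
    by (simp_all only: abs_of_nonneg)
  show "?r * ((\<Sum>i=1..p-1. \<bar>z i\<bar>) + \<bar>?s\<bar>) \<in> (\<lambda>x. \<bar>difference_form p z x\<bar>) ` cube p {a..b}"
    by (rule image_eqI[where f="\<lambda>x. \<bar>difference_form p z x\<bar>", OF max x])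
next
  let ?c = "(a + b) / 2" and ?r = "(b - a) / 2" and ?s = "\<Sum>i=1..p-1. z i"
  fix v assume "v \<in> (\<lambda>x. \<bar>difference_form p z x\<bar>) ` cube p {a..b}"
  then obtain x where x: "x \<in> cube p {a..b}" "v = \<bar>difference_form p z x\<bar>" by blast
  have near: "\<bar>x i - ?c\<bar> \<le> ?r" if "i \<in> {1..p}" for i
  proof -
    have "x i \<in> {a..b}" using x(1) that by (auto simp: PiE_iff)
    then show ?thesis by (auto simp: abs_le_iff field_simps)
  qed
  have "difference_form p z x = (\<Sum>i=1..p-1. z i * (x i - ?c)) - ?s * (x p - ?c)"
    unfolding difference_form_def sum_distrib_right sum_subtractf[symmetric]
    by (intro sum.cong refl) (simp add: algebra_simps)
  then have "v \<le> \<bar>\<Sum>i=1..p-1. z i * (x i - ?c)\<bar> + \<bar>?s * (x p - ?c)\<bar>"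
    unfolding x(2) by (simp only: abs_triangle_ineq4)
  also have "\<bar>\<Sum>i=1..p-1. z i * (x i - ?c)\<bar> \<le> (\<Sum>i=1..p-1. \<bar>z i\<bar> * ?r)"
  proof (rule order_trans[OF sum_abs sum_mono])
    fix i assume "i \<in> {1..p-1}"
    then have "\<bar>x i - ?c\<bar> \<le> ?r" by (intro near) auto
    then show "\<bar>z i * (x i - ?c)\<bar> \<le> \<bar>z i\<bar> * ?r"
      unfolding abs_mult by (rule mult_left_mono) simp
  qed
  also have "\<bar>?s * (x p - ?c)\<bar> \<le> \<bar>?s\<bar> * ?r"
    unfolding abs_mult using assms(2) by (intro mult_left_mono near) auto
  finally show "v \<le> ?r * ((\<Sum>i=1..p-1. \<bar>z i\<bar>) + \<bar>?s\<bar>)"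
    unfolding sum_distrib_right[symmetric] by (simp add: algebra_simps)
qed

text \<open>At a fixed point \<open>x\<close>, a function-valued simple function is a finite sum of
  indicators of its fibres with the values \<open>f x\<close> as coefficients. This links the
  integral in C(I^p) to ordinary integrals.\<close>

lemma (in prob_space) simple_expectation_eq:
  assumes S: "simple_function M S" and x: "x \<in> cube p I"
  shows "integrable M (\<lambda>\<omega>. S \<omega> x)" "simple_expectation M p I S x = expectation (\<lambda>\<omega>. S \<omega> x)"
proof -
  have ind: "integrable M (\<lambda>\<omega>. indicator {\<omega> \<in> space M. S \<omega> = f} \<omega> * f x)"
    "expectation (\<lambda>\<omega>. indicator {\<omega> \<in> space M. S \<omega> = f} \<omega> * f x) = prob {\<omega> \<in> space M. S \<omega> = f} * f x"
    if "f \<in> S ` space M" for f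
  proof -
    have "S -` {f} \<inter> space M \<in> sets M"
      using S that by (auto simp: simple_function_def)
    also have "S -` {f} \<inter> space M = {\<omega> \<in> space M. S \<omega> = f}" by auto
    finally have "{\<omega> \<in> space M. S \<omega> = f} \<in> sets M" .
    then show "integrable M (\<lambda>\<omega>. indicator {\<omega> \<in> space M. S \<omega> = f} \<omega> * f x)"
      "expectation (\<lambda>\<omega>. indicator {\<omega> \<in> space M. S \<omega> = f} \<omega> * f x) = prob {\<omega> \<in> space M. S \<omega> = f} * f x"
      by (simp_all add: emeasure_eq_measure)
  qed
  have eq: "S \<omega> x = (\<Sum>f\<in>S ` space M. indicator {\<omega> \<in> space M. S \<omega> = f} \<omega> * f x)" if "\<omega> \<in> space M" for \<omega>
  proof -
    have "(\<Sum>f\<in>S ` space M. indicator {\<omega> \<in> space M. S \<omega> = f} \<omega> * f x)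
        = (\<Sum>f\<in>S ` space M. if f = S \<omega> then f x else 0)"
      using that by (intro sum.cong) (auto simp: indicator_def)
    also have "\<dots> = S \<omega> x"
      using S that by (simp add: simple_function_def)
    finally show ?thesis by simp
  qed
  show "integrable M (\<lambda>\<omega>. S \<omega> x)"
    using ind(1) by (subst Bochner_Integration.integrable_cong[OF refl eq]) auto
  have "expectation (\<lambda>\<omega>. S \<omega> x)
      = expectation (\<lambda>\<omega>. \<Sum>f\<in>S ` space M. indicator {\<omega> \<in> space M. S \<omega> = f} \<omega> * f x)"
    by (rule Bochner_Integration.integral_cong[OF refl eq])
  also have "\<dots> = (\<Sum>f\<in>S ` space M. expectation (\<lambda>\<omega>. indicator {\<omega> \<in> space M. S \<omega> = f} \<omega> * f x))"
    by (rule Bochner_Integration.integral_sum) (rule ind(1))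
  also have "\<dots> = (\<Sum>f\<in>S ` space M. prob {\<omega> \<in> space M. S \<omega> = f} * f x)"
    by (rule sum.cong[OF refl ind(2)])
  finally have "expectation (\<lambda>\<omega>. S \<omega> x) = (\<Sum>f\<in>S ` space M. prob {\<omega> \<in> space M. S \<omega> = f} * f x)" .
  then show "simple_expectation M p I S x = expectation (\<lambda>\<omega>. S \<omega> x)"
    using x by (simp add: simple_expectation_def)
qed

text \<open>Evaluation at \<open>x\<close> is 1-Lipschitz for the supremum metric, so convergence of
  the approximations in mean and of their integrals both descend to \<open>x\<close>, where limits
  of reals are unique.\<close>

lemma has_bochner_expectation_apply:
  assumes "prob_space P" and has: "has_bochner_expectation P p I M m"
    and M: "\<And>\<omega>. \<omega> \<in> space P \<Longrightarrow> M \<omega> \<in> mspace (CI p I)"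
    and x: "x \<in> cube p I" and int: "integrable P (\<lambda>\<omega>. M \<omega> x)"
  shows "m x = (\<integral>\<omega>. M \<omega> x \<partial>P)"
proof -
  interpret prob_space P by fact
  interpret CI: Metric_space "mspace (CI p I)" "mdist (CI p I)"
    by (rule Metric_space_mspace_mdist)
  obtain S where S: "\<And>k. simple_function P (S k)" "\<And>k. S k ` space P \<subseteq> mspace (CI p I)"
    and dist: "(\<lambda>k::nat. \<integral>\<^sup>+\<omega>. ennreal (mdist (CI p I) (M \<omega>) (S k \<omega>)) \<partial>P) \<longlonglongrightarrow> 0"
    and lim: "limitin (mtopology_of (CI p I)) (\<lambda>k. simple_expectation P p I (S k)) m sequentially"
    using has unfolding has_bochner_expectation_def by blast
  have lim': "m \<in> mspace (CI p I)" "\<forall>\<^sub>F k in sequentially. simple_expectation P p I (S k) \<in> mspace (CI p I)"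
      "(\<lambda>k. mdist (CI p I) (simple_expectation P p I (S k)) m) \<longlonglongrightarrow> 0"
    using lim by (simp_all add: mtopology_of_def CI.limitin_metric_dist_null)
  have "(\<lambda>k. simple_expectation P p I (S k) x - m x) \<longlonglongrightarrow> 0"
  proof (rule Lim_null_comparison[OF _ lim'(3)])
    show "\<forall>\<^sub>F k in sequentially. norm (simple_expectation P p I (S k) x - m x)
        \<le> mdist (CI p I) (simple_expectation P p I (S k)) m"
      using lim'(2) unfolding real_norm_def
      by (rule eventually_mono) (intro abs_diff_le_mdist_CI lim'(1) x)
  qed
  then have to_m: "(\<lambda>k. simple_expectation P p I (S k) x) \<longlonglongrightarrow> m x"
    by (rule LIM_zero_cancel)
  have "(\<lambda>k. ennreal (\<integral>\<omega>. \<bar>M \<omega> x - S k \<omega> x\<bar> \<partial>P)) \<longlonglongrightarrow> 0"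
  proof (rule tendsto_sandwich[OF _ _ tendsto_const dist])
    show "\<forall>\<^sub>F k in sequentially. ennreal (\<integral>\<omega>. \<bar>M \<omega> x - S k \<omega> x\<bar> \<partial>P)
        \<le> (\<integral>\<^sup>+\<omega>. ennreal (mdist (CI p I) (M \<omega>) (S k \<omega>)) \<partial>P)"
    proof (intro always_eventually allI)
      fix k
      have "ennreal (\<integral>\<omega>. \<bar>M \<omega> x - S k \<omega> x\<bar> \<partial>P) = (\<integral>\<^sup>+\<omega>. ennreal \<bar>M \<omega> x - S k \<omega> x\<bar> \<partial>P)"
        using int simple_expectation_eq(1)[OF S(1) x] by (intro nn_integral_eq_integral[symmetric]) auto
      also have "\<dots> \<le> (\<integral>\<^sup>+\<omega>. ennreal (mdist (CI p I) (M \<omega>) (S k \<omega>)) \<partial>P)"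
        using S(2) by (intro nn_integral_mono ennreal_leI abs_diff_le_mdist_CI M x) auto
      finally show "ennreal (\<integral>\<omega>. \<bar>M \<omega> x - S k \<omega> x\<bar> \<partial>P)
          \<le> (\<integral>\<^sup>+\<omega>. ennreal (mdist (CI p I) (M \<omega>) (S k \<omega>)) \<partial>P)" .
    qed
  qed simp
  then have to_0: "(\<lambda>k. \<integral>\<omega>. \<bar>M \<omega> x - S k \<omega> x\<bar> \<partial>P) \<longlonglongrightarrow> 0"
    by (simp flip: ennreal_0)
  have "(\<lambda>k. (\<integral>\<omega>. S k \<omega> x \<partial>P) - (\<integral>\<omega>. M \<omega> x \<partial>P)) \<longlonglongrightarrow> 0"
  proof (rule Lim_null_comparison[OF _ to_0])
    show "\<forall>\<^sub>F k in sequentially. norm ((\<integral>\<omega>. S k \<omega> x \<partial>P) - (\<integral>\<omega>. M \<omega> x \<partial>P)) \<le> (\<integral>\<omega>. \<bar>M \<omega> x - S k \<omega> x\<bar> \<partial>P)"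
    proof (intro always_eventually allI)
      fix k
      have "norm ((\<integral>\<omega>. S k \<omega> x \<partial>P) - (\<integral>\<omega>. M \<omega> x \<partial>P)) = \<bar>\<integral>\<omega>. M \<omega> x - S k \<omega> x \<partial>P\<bar>"
        using int simple_expectation_eq(1)[OF S(1) x] by simp
      also have "\<dots> \<le> (\<integral>\<omega>. \<bar>M \<omega> x - S k \<omega> x\<bar> \<partial>P)"
        by (rule integral_abs_bound)
      finally show "norm ((\<integral>\<omega>. S k \<omega> x \<partial>P) - (\<integral>\<omega>. M \<omega> x \<partial>P)) \<le> (\<integral>\<omega>. \<bar>M \<omega> x - S k \<omega> x\<bar> \<partial>P)" .
    qed
  qed
  then have "(\<lambda>k. simple_expectation P p I (S k) x) \<longlonglongrightarrow> (\<integral>\<omega>. M \<omega> x \<partial>P)"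
    unfolding simple_expectation_eq(2)[OF S(1) x] by (rule LIM_zero_cancel)
  with to_m show ?thesis by (rule LIMSEQ_unique)
qed

text \<open>Two candidates agree at every point of the cube by evaluation and are both undefined
  elsewhere, so the definite description is met by \<open>m\<close> alone.\<close>

lemma bochner_expectation_eqI:
  assumes "prob_space P" "has_bochner_expectation P p I M m"
    and "\<And>\<omega>. \<omega> \<in> space P \<Longrightarrow> M \<omega> \<in> mspace (CI p I)"
    and "\<And>x. x \<in> cube p I \<Longrightarrow> integrable P (\<lambda>\<omega>. M \<omega> x)"
  shows "bochner_expectation P p I M = m"
  unfolding bochner_expectation_def
proof (rule the_equality[where P="has_bochner_expectation P p I M", OF assms(2)])
  fix m' assume m': "has_bochner_expectation P p I M m'"
  have ext: "m \<in> extensional (cube p I)" if "has_bochner_expectation P p I M m" for m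
  proof -
    have "m \<in> topspace (mtopology_of (CI p I))"
      using that unfolding has_bochner_expectation_def by (blast dest: limitin_topspace)
    then show ?thesis by (simp add: CI_def)
  qed
  show "m' = m"
  proof (rule extensionalityI[OF ext[OF m'] ext[OF assms(2)]])
    fix x assume "x \<in> cube p I"
    then show "m' x = m x"
      using has_bochner_expectation_apply[OF assms(1) m' assms(3)]
        has_bochner_expectation_apply[OF assms(1-3)] assms(4) by simp
  qed
qed

text \<open>Finite range and measurable fibres pass to finite tuples; this makes the vector of
  rounded weights a single simple function.\<close>

lemma simple_function_restrict:
  assumes "finite J" "\<And>i. i \<in> J \<Longrightarrow> simple_function M (\<lambda>\<omega>. f \<omega> i)"
  shows "simple_function M (\<lambda>\<omega>. \<lambda>i\<in>J. f \<omega> i)"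
  unfolding simple_function_def
proof (intro conjI ballI)
  have "(\<lambda>\<omega>. \<lambda>i\<in>J. f \<omega> i) ` space M \<subseteq> (\<Pi>\<^sub>E i\<in>J. (\<lambda>\<omega>. f \<omega> i) ` space M)"
    by (auto simp: PiE_iff)
  moreover have "finite (\<Pi>\<^sub>E i\<in>J. (\<lambda>\<omega>. f \<omega> i) ` space M)"
    using assms by (intro finite_PiE) (auto simp: simple_function_def)
  ultimately show "finite ((\<lambda>\<omega>. \<lambda>i\<in>J. f \<omega> i) ` space M)"
    by (rule finite_subset)
  fix v assume "v \<in> (\<lambda>\<omega>. \<lambda>i\<in>J. f \<omega> i) ` space M"
  then obtain \<omega>\<^sub>0 where \<omega>\<^sub>0: "\<omega>\<^sub>0 \<in> space M" "v = (\<lambda>i\<in>J. f \<omega>\<^sub>0 i)" by blast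
  have "{\<omega> \<in> space M. f \<omega> i = v i} \<in> sets M" if "i \<in> J" for i
  proof -
    have "(\<lambda>\<omega>. f \<omega> i) -` {f \<omega>\<^sub>0 i} \<inter> space M \<in> sets M"
      using assms(2)[OF that] \<omega>\<^sub>0(1) unfolding simple_function_def by blast
    also have "(\<lambda>\<omega>. f \<omega> i) -` {f \<omega>\<^sub>0 i} \<inter> space M = {\<omega> \<in> space M. f \<omega> i = v i}"
      using that \<omega>\<^sub>0(2) by auto
    finally show ?thesis .
  qed
  then have "{\<omega> \<in> space M. \<forall>i\<in>J. f \<omega> i = v i} \<in> sets M"
    using assms(1) by (intro sets.sets_Collect_finite_All)
  also have "{\<omega> \<in> space M. \<forall>i\<in>J. f \<omega> i = v i} = (\<lambda>\<omega>. \<lambda>i\<in>J. f \<omega> i) -` {v} \<inter> space M"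
  proof -
    have "restrict g J = v \<longleftrightarrow> (\<forall>i\<in>J. g i = v i)" for g
      unfolding \<omega>\<^sub>0(2) by (metis restrict_apply' restrict_ext)
    then show ?thesis by auto
  qed
  finally show "(\<lambda>\<omega>. \<lambda>i\<in>J. f \<omega> i) -` {v} \<inter> space M \<in> sets M" .
qed

lemma (in prob_space) expectation_difference_form:
  assumes "\<And>i. i \<in> {1..p-1} \<Longrightarrow> integrable M (\<lambda>\<omega>. y \<omega> i)"
  shows "integrable M (\<lambda>\<omega>. x p + difference_form p (y \<omega>) x)"
    "expectation (\<lambda>\<omega>. x p + difference_form p (y \<omega>) x) = x p + difference_form p (\<lambda>i. expectation (\<lambda>\<omega>. y \<omega> i)) x"
proof -
  have int: "integrable M (\<lambda>\<omega>. y \<omega> i * (x i - x p))" if "i \<in> {1..p-1}" for i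
    using assms[OF that] by simp
  then have sum: "integrable M (\<lambda>\<omega>. \<Sum>i=1..p-1. y \<omega> i * (x i - x p))"
    by (rule Bochner_Integration.integrable_sum)
  then show "integrable M (\<lambda>\<omega>. x p + difference_form p (y \<omega>) x)"
    unfolding difference_form_def by (intro Bochner_Integration.integrable_add) auto
  have "expectation (\<lambda>\<omega>. x p + difference_form p (y \<omega>) x)
      = x p + expectation (\<lambda>\<omega>. \<Sum>i=1..p-1. y \<omega> i * (x i - x p))"
    unfolding difference_form_def
    by (subst Bochner_Integration.integral_add) (use sum in \<open>simp_all add: prob_space\<close>)
  also have "expectation (\<lambda>\<omega>. \<Sum>i=1..p-1. y \<omega> i * (x i - x p))
      = (\<Sum>i=1..p-1. expectation (\<lambda>\<omega>. y \<omega> i * (x i - x p)))"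
    by (rule Bochner_Integration.integral_sum) (rule int)
  finally show "expectation (\<lambda>\<omega>. x p + difference_form p (y \<omega>) x)
      = x p + difference_form p (\<lambda>i. expectation (\<lambda>\<omega>. y \<omega> i)) x"
    by (simp add: difference_form_def)
qed

text \<open>By continuity the supremum may be taken over the countable set of points with
  coordinates in a dense subset \<open>T\<close> of the interval.\<close>

lemma borel_measurable_SUP_cube:
  fixes f :: "'w \<Rightarrow> (nat \<Rightarrow> real) \<Rightarrow> real"
  assumes I: "compact I" "I \<noteq> {}"
    and meas: "\<And>x. x \<in> cube p I \<Longrightarrow> (\<lambda>\<omega>. f \<omega> x) \<in> borel_measurable P"
    and cont: "\<And>\<omega>. \<omega> \<in> space P \<Longrightarrow> continuous_map (cube_topology p I) euclideanreal (f \<omega>)"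
  shows "(\<lambda>\<omega>. SUP x\<in>cube p I. f \<omega> x) \<in> borel_measurable P"
proof -
  obtain T where T: "countable T" "T \<subseteq> I" "I \<subseteq> closure T"
    by (rule separable)
  let ?D = "cube p T"
  have "T \<noteq> {}" using T(3) I(2) by auto
  then have D_ne: "?D \<noteq> {}" by (simp add: PiE_eq_empty_iff)
  have D_sub: "?D \<subseteq> cube p I" using T(2) by (intro PiE_mono)
  have bdd: "bdd_above (f \<omega> ` cube p I)" if "\<omega> \<in> space P" for \<omega>
  proof -
    have "compactin euclideanreal (f \<omega> ` cube p I)"
      using compactin_cube[OF I(1)] cont[OF that] by (rule image_compactin)
    then show ?thesis
      by (simp add: compact_imp_bounded bounded_imp_bdd_above)
  qed
  have bddD: "bdd_above (f \<omega> ` ?D)" if "\<omega> \<in> space P" for \<omega>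
    using bdd[OF that] D_sub by (rule bdd_above_mono[OF _ image_mono])
  have eq: "(SUP x\<in>cube p I. f \<omega> x) = (SUP x\<in>?D. f \<omega> x)" if \<omega>: "\<omega> \<in> space P" for \<omega>
  proof (rule antisym)
    show "(SUP x\<in>?D. f \<omega> x) \<le> (SUP x\<in>cube p I. f \<omega> x)"
      using D_ne bdd[OF \<omega>] D_sub by (intro cSUP_subset_mono) auto
    show "(SUP x\<in>cube p I. f \<omega> x) \<le> (SUP x\<in>?D. f \<omega> x)"
    proof (rule cSUP_least)
      show "cube p I \<noteq> {}" using D_ne D_sub by blast
      fix x assume x: "x \<in> cube p I"
      have "\<exists>s. (\<forall>n::nat. s n \<in> T) \<and> s \<longlonglongrightarrow> x i" if "i \<in> {1..p}" for i
      proof -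
        have "x i \<in> closure T" using x that T(3) by (auto simp: PiE_iff)
        then show ?thesis by (simp add: closure_sequential)
      qed
      then obtain s where s: "\<And>i n. i \<in> {1..p} \<Longrightarrow> s i n \<in> T" "\<And>i. i \<in> {1..p} \<Longrightarrow> s i \<longlonglongrightarrow> x i"
        by metis
      let ?X = "\<lambda>n. \<lambda>i\<in>{1..p}. s i n"
      have X: "?X n \<in> ?D" for n using s(1) by auto
      have "limitin (cube_topology p I) ?X x sequentially"
        unfolding limitin_componentwise
      proof (intro conjI ballI)
        show "x \<in> extensional {1..p}" using x by (simp add: PiE_iff)
        show "\<forall>\<^sub>F n in sequentially. ?X n \<in> topspace (cube_topology p I)"
          unfolding topspace_cube using X D_sub by (intro always_eventually) blast
        show "limitin (top_of_set I) (\<lambda>n. ?X n i) (x i) sequentially" if "i \<in> {1..p}" for i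
          using s[OF that] x that T(2) by (auto simp: limitin_subtopology PiE_iff intro!: always_eventually)
      qed
      then have "limitin euclideanreal (f \<omega> \<circ> ?X) (f \<omega> x) sequentially"
        using continuous_map_limit[OF cont[OF \<omega>]] by blast
      then have "(\<lambda>n. f \<omega> (?X n)) \<longlonglongrightarrow> f \<omega> x"
        by (simp add: comp_def)
      then show "f \<omega> x \<le> (SUP x\<in>?D. f \<omega> x)"
        by (rule LIMSEQ_le_const2) (intro exI allI impI cSUP_upper X bddD \<omega>)
    qed
  qed
  have "(\<lambda>\<omega>. SUP x\<in>?D. f \<omega> x) \<in> borel_measurable P"
  proof (rule borel_measurable_cSUP)
    show "countable ?D" using T(1) by (intro countable_PiE) auto
  qed (use meas D_sub bddD in auto)
  then show ?thesis
    by (rule measurable_cong[THEN iffD1, rotated]) (rule eq[symmetric])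
qed

text \<open>Rounding the weights to a grid of mesh \<open>1 / (k + 1)\<close> gives simple
  functions, and the Lipschitz estimate makes the error in C(I^p) at most \<open>C / (k + 1)\<close>
  uniformly in \<open>\<omega>\<close>.\<close>

lemma has_bochner_expectation_weighted:
  assumes "prob_space P" "p \<ge> 2" "a \<le> b" and \<xi>: "\<xi> \<in> P \<rightarrow>\<^sub>M Rd (p - 1)"
    and nonneg: "\<And>\<omega> i. \<omega> \<in> space P \<Longrightarrow> i \<in> {1..p-1} \<Longrightarrow> 0 \<le> \<xi> \<omega> i"
    and le1: "AE \<omega> in P. (\<Sum>i=1..p-1. \<xi> \<omega> i) \<le> 1"
    and m0: "m\<^sub>0 \<in> mspace (CI p {a..b})"
    and M: "\<And>\<omega>. \<omega> \<in> space P \<Longrightarrow>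
      M \<omega> = (if (\<Sum>i=1..p-1. \<xi> \<omega> i) \<le> 1 then weighted_mean p {a..b} (\<xi> \<omega>) else m\<^sub>0)"
    and M_meas: "M \<in> P \<rightarrow>\<^sub>M borel_of (mtopology_of (CI p {a..b}))"
  shows "has_bochner_expectation P p {a..b} M (weighted_mean p {a..b} (\<lambda>i. \<integral>\<omega>. \<xi> \<omega> i \<partial>P))"
proof -
  interpret prob_space P by fact
  interpret CI: Metric_space "mspace (CI p {a..b})" "mdist (CI p {a..b})"
    by (rule Metric_space_mspace_mdist)
  let ?J = "{1..p-1}" and ?w = "weighted_mean p {a..b}"
  let ?good = "\<lambda>\<omega>. (\<Sum>i\<in>?J. \<xi> \<omega> i) \<le> 1"
  \<comment> \<open>Lipschitz constant \<open>b - a\<close> times the number of weights, each moved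
    by at most one mesh.\<close>
  define C where "C = (b - a) * real (p - 1)"
  have \<xi>_meas: "(\<lambda>\<omega>. \<xi> \<omega> i) \<in> borel_measurable P" if "i \<in> ?J" for i
    using that by (intro measurable_compose[OF \<xi>] measurable_component_singleton)
  have good_sets: "{\<omega> \<in> space P. ?good \<omega>} \<in> sets P"
    using borel_measurable_sum[OF \<xi>_meas] by measurable
  have \<xi>_le1: "\<xi> \<omega> i \<le> 1" if "\<omega> \<in> space P" "?good \<omega>" "i \<in> ?J" for \<omega> i
  proof -
    have "\<xi> \<omega> i \<le> (\<Sum>i\<in>?J. \<xi> \<omega> i)"
      using that nonneg by (intro member_le_sum) auto
    with that(2) show ?thesis by linarith
  qed
  have \<xi>_int: "integrable P (\<lambda>\<omega>. \<xi> \<omega> i)" if "i \<in> ?J" for i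
  proof (rule integrable_const_bound[of _ 1])
    show "AE \<omega> in P. norm (\<xi> \<omega> i) \<le> 1"
      using le1 AE_space
    proof eventually_elim
      case (elim \<omega>)
      then show ?case
        using \<xi>_le1[OF elim(2,1) that] nonneg[OF elim(2) that] by simp
    qed
  qed (rule \<xi>_meas[OF that])
  \<comment> \<open>The cap at 1 keeps the range finite even where the weights are too large; on the
    good event every weight is at most 1 and the cap changes nothing.\<close>
  define q where "q k u = real_of_int \<lfloor>real (Suc k) * min 1 u\<rfloor> / real (Suc k)" for k u
  define r where "r k \<omega> = (\<lambda>i\<in>?J. q k (\<xi> \<omega> i))" for k \<omega>
  \<comment> \<open>Copying \<open>m\<^sub>0\<close> makes the distance to \<open>M\<close> exactly
    0 on the exceptional event. The rounded weights need only give an element of C(I^p).\<close>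
  define S where "S k \<omega> = (if ?good \<omega> then ?w (r k \<omega>) else m\<^sub>0)" for k \<omega>
  have q_near: "\<bar>u - q k u\<bar> \<le> 1 / real (Suc k)" if "u \<le> 1" for k u
  proof -
    have "\<bar>real (Suc k) * u - real_of_int \<lfloor>real (Suc k) * u\<rfloor>\<bar> \<le> 1" by linarith
    then have "\<bar>real (Suc k) * u - real_of_int \<lfloor>real (Suc k) * u\<rfloor>\<bar> / real (Suc k) \<le> 1 / real (Suc k)"
      by (intro divide_right_mono) auto
    moreover have "\<bar>real (Suc k) * u - real_of_int \<lfloor>real (Suc k) * u\<rfloor>\<bar> / real (Suc k)
        = \<bar>(real (Suc k) * u - real_of_int \<lfloor>real (Suc k) * u\<rfloor>) / real (Suc k)\<bar>"
      by (simp only: abs_divide abs_of_nat)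
    moreover have "(real (Suc k) * u - real_of_int \<lfloor>real (Suc k) * u\<rfloor>) / real (Suc k) = u - q k u"
      using that unfolding q_def by (simp add: diff_divide_distrib min_absorb2)
    ultimately show ?thesis by (simp only:)
  qed
  have r_simple: "simple_function P (\<lambda>\<omega>. q k (\<xi> \<omega> i))" if i: "i \<in> ?J" for k i
  proof (rule simple_function_borel_measurable)
    show "(\<lambda>\<omega>. q k (\<xi> \<omega> i)) \<in> borel_measurable P"
      unfolding q_def using \<xi>_meas[OF i] by measurable
    have "q k (\<xi> \<omega> i) \<in> (\<lambda>j. real_of_int j / real (Suc k)) ` {0..int (Suc k)}" if "\<omega> \<in> space P" for \<omega>
    proof -
      have "0 \<le> real (Suc k) * min 1 (\<xi> \<omega> i)"
        using nonneg[OF that i] by simp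
      moreover have "real (Suc k) * min 1 (\<xi> \<omega> i) \<le> real (Suc k)"
        by (rule mult_left_le) auto
      then have "\<lfloor>real (Suc k) * min 1 (\<xi> \<omega> i)\<rfloor> \<le> \<lfloor>real (Suc k)\<rfloor>"
        by (rule floor_mono)
      then have "\<lfloor>real (Suc k) * min 1 (\<xi> \<omega> i)\<rfloor> \<le> int (Suc k)"
        by (simp only: floor_of_nat)
      ultimately have "\<lfloor>real (Suc k) * min 1 (\<xi> \<omega> i)\<rfloor> \<in> {0..int (Suc k)}"
        by (simp only: atLeastAtMost_iff zero_le_floor simp_thms)
      then show ?thesis unfolding q_def by blast
    qed
    then have "(\<lambda>\<omega>. q k (\<xi> \<omega> i)) ` space P \<subseteq> (\<lambda>j. real_of_int j / real (Suc k)) ` {0..int (Suc k)}"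
      by (rule image_subsetI)
    then show "finite ((\<lambda>\<omega>. q k (\<xi> \<omega> i)) ` space P)"
      by (rule finite_subset) simp
  qed
  have r_int: "integrable P (\<lambda>\<omega>. r k \<omega> i)" if "i \<in> ?J" for k i
  proof -
    have "(\<lambda>\<omega>. q k (\<xi> \<omega> i)) \<in> borel_measurable P"
      unfolding q_def using \<xi>_meas[OF that] by measurable
    then have "integrable P (\<lambda>\<omega>. q k (\<xi> \<omega> i))"
      using r_simple[OF that, of k] by (intro finite_borel_measurable_integrable) (auto simp: simple_function_def)
    with that show ?thesis by (simp add: r_def)
  qed
  have near: "\<bar>\<xi> \<omega> i - r k \<omega> i\<bar> \<le> 1 / real (Suc k)" if "\<omega> \<in> space P" "?good \<omega>" "i \<in> ?J" for \<omega> i k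
    using q_near[OF \<xi>_le1[OF that]] that(3) by (simp only: r_def restrict_apply if_True)
  have C_bound: "(b - a) * (\<Sum>i\<in>?J. h i) \<le> C / real (Suc k)" if "\<And>i. i \<in> ?J \<Longrightarrow> h i \<le> 1 / real (Suc k)" for h k
  proof -
    have "(\<Sum>i\<in>?J. h i) \<le> (\<Sum>i\<in>?J. 1 / real (Suc k))"
      using that by (rule sum_mono)
    then have "(b - a) * (\<Sum>i\<in>?J. h i) \<le> (b - a) * (\<Sum>i\<in>?J. 1 / real (Suc k))"
      using assms(3) by (intro mult_left_mono) auto
    then show ?thesis by (simp add: C_def)
  qed
  have C_lim: "(\<lambda>k. C / real (Suc k)) \<longlonglongrightarrow> 0"
    by (intro LIMSEQ_Suc lim_const_over_n)
  have C_nonneg: "0 \<le> C / real (Suc k)" for k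
    using assms(3) by (simp add: C_def)
  have w_mspace: "?w y \<in> mspace (CI p {a..b})" for y
    using assms(2) by (intro weighted_mean_in_mspace) auto
  have S_simple: "simple_function P (S k)" for k
  proof -
    have "simple_function P (r k)"
      unfolding r_def[abs_def] by (rule simple_function_restrict[OF finite_atLeastAtMost r_simple])
    then have "simple_function P (\<lambda>\<omega>. ?w (r k \<omega>))"
      by (rule simple_function_compose1)
    then show ?thesis
      unfolding S_def[abs_def] using good_sets by (intro simple_function_If) auto
  qed
  have dist: "(\<lambda>k. \<integral>\<^sup>+\<omega>. ennreal (mdist (CI p {a..b}) (M \<omega>) (S k \<omega>)) \<partial>P) \<longlonglongrightarrow> 0"
  proof (rule tendsto_sandwich[OF _ _ tendsto_const])
    show "(\<lambda>k. ennreal (C / real (Suc k))) \<longlonglongrightarrow> 0"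
      using tendsto_ennrealI[OF C_lim] by simp
    show "\<forall>\<^sub>F k in sequentially. (\<integral>\<^sup>+\<omega>. ennreal (mdist (CI p {a..b}) (M \<omega>) (S k \<omega>)) \<partial>P) \<le> ennreal (C / real (Suc k))"
    proof (intro always_eventually allI)
      fix k
      have "mdist (CI p {a..b}) (M \<omega>) (S k \<omega>) \<le> C / real (Suc k)" if \<omega>: "\<omega> \<in> space P" for \<omega>
      proof (cases "?good \<omega>")
        case True
        have "mdist (CI p {a..b}) (?w (\<xi> \<omega>)) (?w (r k \<omega>)) \<le> (b - a) * (\<Sum>i\<in>?J. \<bar>\<xi> \<omega> i - r k \<omega> i\<bar>)"
          using assms(2,3) by (rule mdist_weighted_mean_le)
        also have "\<dots> \<le> C / real (Suc k)"
          using near[OF \<omega> True] by (rule C_bound)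
        finally show ?thesis
          using True unfolding M[OF \<omega>] S_def by (simp only: if_True)
      next
        case False
        then have "M \<omega> = m\<^sub>0" "S k \<omega> = m\<^sub>0"
          unfolding M[OF \<omega>] S_def by (simp_all only: if_False)
        then show ?thesis
          using C_nonneg[of k] m0 by (simp only: CI.mdist_zero)
      qed
      then have "(\<integral>\<^sup>+\<omega>. ennreal (mdist (CI p {a..b}) (M \<omega>) (S k \<omega>)) \<partial>P) \<le> (\<integral>\<^sup>+\<omega>. ennreal (C / real (Suc k)) \<partial>P)"
        by (intro nn_integral_mono ennreal_leI)
      then show "(\<integral>\<^sup>+\<omega>. ennreal (mdist (CI p {a..b}) (M \<omega>) (S k \<omega>)) \<partial>P) \<le> ennreal (C / real (Suc k))"
        by (simp add: emeasure_space_1)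
    qed
  qed simp
  \<comment> \<open>The exceptional event is null, so \<open>m\<^sub>0\<close> contributes nothing,
    and the expectation moves onto the weights because they enter affinely.\<close>
  have se: "simple_expectation P p {a..b} (S k) = ?w (\<lambda>i. expectation (\<lambda>\<omega>. r k \<omega> i))" for k
  proof (rule extensionalityI)
    show "simple_expectation P p {a..b} (S k) \<in> extensional (cube p {a..b})"
      "?w (\<lambda>i. expectation (\<lambda>\<omega>. r k \<omega> i)) \<in> extensional (cube p {a..b})"
      by (simp_all add: simple_expectation_def weighted_mean_def)
    fix x assume x: "x \<in> cube p {a..b}"
    have "simple_expectation P p {a..b} (S k) x = expectation (\<lambda>\<omega>. S k \<omega> x)"
      using S_simple x by (rule simple_expectation_eq(2))
    also have "\<dots> = expectation (\<lambda>\<omega>. x p + difference_form p (r k \<omega>) x)"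
    proof (rule integral_cong_AE)
      show "(\<lambda>\<omega>. S k \<omega> x) \<in> borel_measurable P"
        by (rule borel_measurable_integrable[OF simple_expectation_eq(1)[OF S_simple x]])
      show "(\<lambda>\<omega>. x p + difference_form p (r k \<omega>) x) \<in> borel_measurable P"
        by (rule borel_measurable_integrable[OF expectation_difference_form(1)[OF r_int]])
      show "AE \<omega> in P. S k \<omega> x = x p + difference_form p (r k \<omega>) x"
        using le1 by eventually_elim (simp only: S_def if_True weighted_mean_apply[OF x])
    qed
    also have "\<dots> = ?w (\<lambda>i. expectation (\<lambda>\<omega>. r k \<omega> i)) x"
      using expectation_difference_form(2)[OF r_int] by (simp only: weighted_mean_apply[OF x])
    finally show "simple_expectation P p {a..b} (S k) x = ?w (\<lambda>i. expectation (\<lambda>\<omega>. r k \<omega> i)) x" .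
  qed
  have mean_near: "\<bar>expectation (\<lambda>\<omega>. r k \<omega> i) - expectation (\<lambda>\<omega>. \<xi> \<omega> i)\<bar> \<le> 1 / real (Suc k)" if i: "i \<in> ?J" for k i
  proof -
    have "\<bar>expectation (\<lambda>\<omega>. r k \<omega> i) - expectation (\<lambda>\<omega>. \<xi> \<omega> i)\<bar> = \<bar>expectation (\<lambda>\<omega>. r k \<omega> i - \<xi> \<omega> i)\<bar>"
      using r_int[OF i] \<xi>_int[OF i] by simp
    also have "\<dots> \<le> expectation (\<lambda>\<omega>. \<bar>r k \<omega> i - \<xi> \<omega> i\<bar>)"
      by (rule integral_abs_bound)
    also have "\<dots> \<le> expectation (\<lambda>\<omega>. 1 / real (Suc k))"
    proof (rule integral_mono_AE)
      show "integrable P (\<lambda>\<omega>. \<bar>r k \<omega> i - \<xi> \<omega> i\<bar>)"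
        using r_int[OF i] \<xi>_int[OF i] by simp
      show "AE \<omega> in P. \<bar>r k \<omega> i - \<xi> \<omega> i\<bar> \<le> 1 / real (Suc k)"
        using le1 AE_space
      proof eventually_elim
        case (elim \<omega>)
        show ?case
          using near[OF elim(2,1) i] by (simp only: abs_minus_commute)
      qed
    qed simp
    finally show ?thesis by (simp add: prob_space)
  qed
  have "limitin (mtopology_of (CI p {a..b})) (\<lambda>k. simple_expectation P p {a..b} (S k))
      (?w (\<lambda>i. expectation (\<lambda>\<omega>. \<xi> \<omega> i))) sequentially"
    unfolding mtopology_of_def CI.limitin_metric_dist_null se
  proof (intro conjI w_mspace always_eventually allI)
    show "(\<lambda>k. mdist (CI p {a..b}) (?w (\<lambda>i. expectation (\<lambda>\<omega>. r k \<omega> i)))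
        (?w (\<lambda>i. expectation (\<lambda>\<omega>. \<xi> \<omega> i)))) \<longlonglongrightarrow> 0"
    proof (rule Lim_null_comparison[OF _ C_lim], intro always_eventually allI)
      fix k
      have "mdist (CI p {a..b}) (?w (\<lambda>i. expectation (\<lambda>\<omega>. r k \<omega> i))) (?w (\<lambda>i. expectation (\<lambda>\<omega>. \<xi> \<omega> i)))
          \<le> (b - a) * (\<Sum>i\<in>?J. \<bar>expectation (\<lambda>\<omega>. r k \<omega> i) - expectation (\<lambda>\<omega>. \<xi> \<omega> i)\<bar>)"
        using assms(2,3) by (rule mdist_weighted_mean_le)
      also have "\<dots> \<le> C / real (Suc k)"
        using mean_near by (rule C_bound)
      finally show "norm (mdist (CI p {a..b}) (?w (\<lambda>i. expectation (\<lambda>\<omega>. r k \<omega> i)))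
          (?w (\<lambda>i. expectation (\<lambda>\<omega>. \<xi> \<omega> i)))) \<le> C / real (Suc k)"
        by (simp only: real_norm_def abs_of_nonneg[OF CI.nonneg])
    qed
  qed
  moreover have "S k ` space P \<subseteq> mspace (CI p {a..b})" for k
    using w_mspace m0 by (auto simp: S_def)
  ultimately show ?thesis
    unfolding has_bochner_expectation_def using M_meas S_simple dist by blast
qed

section \<open>Independent identically distributed weights\<close>

locale iid_weights = prob_space P for P :: "'w measure" +
  fixes d :: nat and \<xi> :: "nat \<Rightarrow> 'w \<Rightarrow> nat \<Rightarrow> real"
  assumes indep: "indep_vars (\<lambda>_. Rd d) \<xi> {1..}"
    and distr: "n \<ge> 1 \<Longrightarrow> distr P (Rd d) (\<xi> n) = distr P (Rd d) (\<xi> 1)"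
    and nonneg: "n \<ge> 1 \<Longrightarrow> \<omega> \<in> space P \<Longrightarrow> i \<in> {1..d} \<Longrightarrow> 0 \<le> \<xi> n \<omega> i"
    and le1: "AE \<omega> in P. (\<Sum>i=1..d. \<xi> 1 \<omega> i) \<le> 1"
begin

abbreviation \<mu> :: "nat \<Rightarrow> real" where "\<mu> i \<equiv> expectation (\<lambda>\<omega>. \<xi> 1 \<omega> i)"

lemma rv: "n \<ge> 1 \<Longrightarrow> \<xi> n \<in> P \<rightarrow>\<^sub>M Rd d"
  using indep unfolding indep_vars_def2 by auto

lemma rv_component: "n \<ge> 1 \<Longrightarrow> i \<in> {1..d} \<Longrightarrow> (\<lambda>\<omega>. \<xi> n \<omega> i) \<in> borel_measurable P"
  by (rule measurable_compose[OF rv measurable_component_singleton])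

lemma indep_function:
  "h \<in> borel_measurable (Rd d) \<Longrightarrow> indep_vars (\<lambda>_. borel) (\<lambda>n \<omega>. h (\<xi> n \<omega>)) {1..}"
  using indep by (rule indep_vars_compose2)

lemma distr_function:
  assumes "n \<ge> 1" "h \<in> borel_measurable (Rd d)"
  shows "distr P borel (\<lambda>\<omega>. h (\<xi> n \<omega>)) = distr P borel (\<lambda>\<omega>. h (\<xi> 1 \<omega>))"
  using distr_distr[OF assms(2) rv[OF assms(1)]] distr_distr[OF assms(2) rv[of 1]] distr[OF assms(1)]
  by (simp add: comp_def)

text \<open>The common law transfers the bound from \<open>\<xi> 1\<close> to each
  \<open>\<xi> n\<close>; countability then gives one null set off which every \<open>M n\<close>
  follows its formula.\<close>

lemma AE_le1: "AE \<omega> in P. \<forall>n\<in>{1..}. (\<Sum>i=1..d. \<xi> n \<omega> i) \<le> 1"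
proof (subst AE_ball_countable)
  show "\<forall>n\<in>{1..}. AE \<omega> in P. (\<Sum>i=1..d. \<xi> n \<omega> i) \<le> 1"
  proof
    fix n :: nat assume "n \<in> {1..}"
    then have n: "n \<ge> 1" by simp
    have "{y \<in> space (Rd d). (\<Sum>i=1..d. y i) \<le> 1} \<in> sets (Rd d)" by measurable
    note iff = AE_distr_iff[OF rv this]
    show "AE \<omega> in P. (\<Sum>i=1..d. \<xi> n \<omega> i) \<le> 1"
      using iff[OF n] iff[OF order_refl] le1 unfolding distr[OF n] by blast
  qed
qed simp

lemma component_le1:
  assumes "n \<ge> 1" "\<omega> \<in> space P" "(\<Sum>i=1..d. \<xi> n \<omega> i) \<le> 1" "i \<in> {1..d}"
  shows "\<xi> n \<omega> i \<le> 1"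
proof -
  have "\<xi> n \<omega> i \<le> (\<Sum>i=1..d. \<xi> n \<omega> i)"
    using assms nonneg by (intro member_le_sum) auto
  with assms(3) show ?thesis by linarith
qed

lemma component_AE: "i \<in> {1..d} \<Longrightarrow> AE \<omega> in P. \<xi> 1 \<omega> i \<in> {0..1}"
  using le1 AE_space
proof eventually_elim
  case (elim \<omega>)
  then show ?case
    using component_le1[of 1 \<omega> i] nonneg[of 1 \<omega> i] by simp
qed

lemma integrable_component: "i \<in> {1..d} \<Longrightarrow> integrable P (\<lambda>\<omega>. \<xi> 1 \<omega> i)"
  by (rule integrable_const_bound[of _ 1]) (use component_AE[of i] rv_component[of 1 i] in \<open>auto elim: eventually_mono\<close>)

lemma integrable_centered:
  assumes "i \<in> {1..d}" "k \<in> {1..d}"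
  shows "integrable P (\<lambda>\<omega>. (\<xi> 1 \<omega> i - \<mu> i) * (\<xi> 1 \<omega> k - \<mu> k))"
proof (rule integrable_const_bound[of _ "(1 + \<bar>\<mu> i\<bar>) * (1 + \<bar>\<mu> k\<bar>)"])
  show "AE \<omega> in P. norm ((\<xi> 1 \<omega> i - \<mu> i) * (\<xi> 1 \<omega> k - \<mu> k)) \<le> (1 + \<bar>\<mu> i\<bar>) * (1 + \<bar>\<mu> k\<bar>)"
    using component_AE[OF assms(1)] component_AE[OF assms(2)]
  proof eventually_elim
    case (elim \<omega>)
    then have "\<bar>\<xi> 1 \<omega> i - \<mu> i\<bar> \<le> 1 + \<bar>\<mu> i\<bar>" "\<bar>\<xi> 1 \<omega> k - \<mu> k\<bar> \<le> 1 + \<bar>\<mu> k\<bar>"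
      by auto
    then show ?case
      unfolding real_norm_def abs_mult by (intro mult_mono) auto
  qed
  show "(\<lambda>\<omega>. (\<xi> 1 \<omega> i - \<mu> i) * (\<xi> 1 \<omega> k - \<mu> k)) \<in> borel_measurable P"
    using rv_component[of 1] assms by (intro borel_measurable_times borel_measurable_diff) auto
qed

text \<open>The one-dimensional projection of the Cramer-Wold device.\<close>

definition centered :: "(nat \<Rightarrow> real) \<Rightarrow> (nat \<Rightarrow> real) \<Rightarrow> real" where
  "centered t y = (\<Sum>i=1..d. t i * (y i - \<mu> i))"

lemma centered_measurable: "centered t \<in> borel_measurable (Rd d)"
  unfolding centered_def[abs_def] by measurable

lemma expectation_centered: "expectation (\<lambda>\<omega>. centered t (\<xi> 1 \<omega>)) = 0"
proof -
  have "expectation (\<lambda>\<omega>. centered t (\<xi> 1 \<omega>)) = (\<Sum>i=1..d. expectation (\<lambda>\<omega>. t i * (\<xi> 1 \<omega> i - \<mu> i)))"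
    unfolding centered_def by (rule Bochner_Integration.integral_sum) (use integrable_component in auto)
  also have "\<dots> = 0"
    using integrable_component by (intro sum.neutral ballI) (simp add: prob_space)
  finally show ?thesis .
qed

text \<open>Being a variance, the quadratic form of the covariance matrix is nonnegative, as the
  existence of the normal law requires; it is also the exponent in the limiting characteristic
  function.\<close>

lemma centered_square:
  shows "integrable P (\<lambda>\<omega>. (centered t (\<xi> 1 \<omega>))\<^sup>2)"
    and "expectation (\<lambda>\<omega>. (centered t (\<xi> 1 \<omega>))\<^sup>2) = (\<Sum>i=1..d. \<Sum>k=1..d. t i * Cov P (\<xi> 1) i k * t k)"
proof -
  have eq: "(centered t y)\<^sup>2 = (\<Sum>i=1..d. \<Sum>k=1..d. t i * t k * ((y i - \<mu> i) * (y k - \<mu> k)))" for y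
    unfolding centered_def power2_eq_square sum_product by (simp only: mult_ac)
  have int: "integrable P (\<lambda>\<omega>. t i * t k * ((\<xi> 1 \<omega> i - \<mu> i) * (\<xi> 1 \<omega> k - \<mu> k)))"
    if "i \<in> {1..d}" "k \<in> {1..d}" for i k
    using that by (intro integrable_mult_right integrable_centered)
  show "integrable P (\<lambda>\<omega>. (centered t (\<xi> 1 \<omega>))\<^sup>2)"
    unfolding eq by (intro Bochner_Integration.integrable_sum int)
  have "expectation (\<lambda>\<omega>. (centered t (\<xi> 1 \<omega>))\<^sup>2)
      = (\<Sum>i=1..d. expectation (\<lambda>\<omega>. \<Sum>k=1..d. t i * t k * ((\<xi> 1 \<omega> i - \<mu> i) * (\<xi> 1 \<omega> k - \<mu> k))))"
    unfolding eq by (intro Bochner_Integration.integral_sum Bochner_Integration.integrable_sum int)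
  also have "\<dots> = (\<Sum>i=1..d. \<Sum>k=1..d. t i * Cov P (\<xi> 1) i k * t k)"
  proof (rule sum.cong[OF refl])
    fix i assume "i \<in> {1..d}"
    then have "expectation (\<lambda>\<omega>. \<Sum>k=1..d. t i * t k * ((\<xi> 1 \<omega> i - \<mu> i) * (\<xi> 1 \<omega> k - \<mu> k)))
        = (\<Sum>k=1..d. expectation (\<lambda>\<omega>. t i * t k * ((\<xi> 1 \<omega> i - \<mu> i) * (\<xi> 1 \<omega> k - \<mu> k))))"
      by (intro Bochner_Integration.integral_sum int)
    also have "\<dots> = (\<Sum>k=1..d. t i * Cov P (\<xi> 1) i k * t k)"
      unfolding Cov_def by (intro sum.cong refl) simp
    finally show "expectation (\<lambda>\<omega>. \<Sum>k=1..d. t i * t k * ((\<xi> 1 \<omega> i - \<mu> i) * (\<xi> 1 \<omega> k - \<mu> k)))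
        = (\<Sum>k=1..d. t i * Cov P (\<xi> 1) i k * t k)" .
  qed
  finally show "expectation (\<lambda>\<omega>. (centered t (\<xi> 1 \<omega>))\<^sup>2) = (\<Sum>i=1..d. \<Sum>k=1..d. t i * Cov P (\<xi> 1) i k * t k)" .
qed

lemma normal_law_Cov_exists: "\<exists>\<nu>. normal_law d (\<lambda>_. 0) (Cov P (\<xi> 1)) \<nu>"
proof (rule normal_law_exists)
  show "Cov P (\<xi> 1) i k = Cov P (\<xi> 1) k i" for i k
    by (simp add: Cov_def mult.commute)
  show "(\<Sum>i=1..d. \<Sum>k=1..d. t i * Cov P (\<xi> 1) i k * t k) \<ge> 0" for t
    unfolding centered_square(2)[symmetric] by simp
qed

lemma strong_law:
  assumes "i \<in> {1..d}"
  shows "AE \<omega> in P. (\<lambda>n. (\<Sum>j=1..n. \<xi> j \<omega> i) / real n) \<longlonglongrightarrow> \<mu> i"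
proof (rule strong_law_bounded)
  have h: "(\<lambda>y. y i) \<in> borel_measurable (Rd d)"
    using assms by (rule measurable_component_singleton)
  show "indep_vars (\<lambda>_. borel) (\<lambda>n \<omega>. \<xi> n \<omega> i) {1..}"
    using indep_function[OF h] .
  show "distr P borel (\<lambda>\<omega>. \<xi> n \<omega> i) = distr P borel (\<lambda>\<omega>. \<xi> 1 \<omega> i)" if "n \<ge> 1" for n
    using distr_function[OF that h] .
  show "AE \<omega> in P. \<xi> 1 \<omega> i \<in> {0..1}"
    using assms by (rule component_AE)
qed

text \<open>The normalized centered sum of the central limit theorem, restricted so as to be a point
  of \<open>Rd d\<close>; at n = 0 all its coordinates are 0.\<close>

definition Z :: "nat \<Rightarrow> 'w \<Rightarrow> nat \<Rightarrow> real" where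
  "Z n \<omega> = (\<lambda>i\<in>{1..d}. (\<Sum>j=1..n. \<xi> j \<omega> i - \<mu> i) / sqrt n)"

lemma Z_measurable: "Z n \<in> P \<rightarrow>\<^sub>M Rd d"
  unfolding Z_def[abs_def]
  by (intro measurable_restrict borel_measurable_divide borel_measurable_sum borel_measurable_diff rv_component) auto

lemma Z_form: "(\<Sum>i=1..d. t i * Z n \<omega> i) = (\<Sum>j=1..n. centered t (\<xi> j \<omega>)) / sqrt n"
proof -
  have "(\<Sum>i=1..d. t i * Z n \<omega> i) = (\<Sum>i=1..d. \<Sum>j=1..n. t i * (\<xi> j \<omega> i - \<mu> i)) / sqrt n"
    unfolding sum_divide_distrib by (intro sum.cong refl) (simp add: Z_def sum_distrib_left sum_divide_distrib)
  also have "(\<Sum>i=1..d. \<Sum>j=1..n. t i * (\<xi> j \<omega> i - \<mu> i)) = (\<Sum>j=1..n. centered t (\<xi> j \<omega>))"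
    unfolding centered_def by (rule sum.swap)
  finally show ?thesis .
qed

text \<open>Cramer-Wold: the characteristic function of \<open>Z n\<close> at \<open>t\<close> is
  that of a normalized sum of the iid real variables \<open>centered t (\<xi> j)\<close> at
  1.\<close>

lemma char_Z_tendsto:
  "(\<lambda>n. \<integral>z. iexp (\<Sum>i=1..d. t i * z i) \<partial>distr P (Rd d) (Z n)) \<longlonglongrightarrow>
    exp (- of_real ((\<Sum>i=1..d. \<Sum>k=1..d. t i * Cov P (\<xi> 1) i k * t k) / 2))"
proof -
  have "(\<lambda>n. \<integral>\<omega>. iexp ((\<Sum>j=1..n. centered t (\<xi> j \<omega>)) / sqrt n) \<partial>P) \<longlonglongrightarrow>
      exp (- of_real (expectation (\<lambda>\<omega>. (centered t (\<xi> 1 \<omega>))\<^sup>2) / 2))"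
  proof (rule central_limit_char)
    show "indep_vars (\<lambda>_. borel) (\<lambda>n \<omega>. centered t (\<xi> n \<omega>)) {1..}"
      by (rule indep_function[OF centered_measurable])
    show "distr P borel (\<lambda>\<omega>. centered t (\<xi> n \<omega>)) = distr P borel (\<lambda>\<omega>. centered t (\<xi> 1 \<omega>))" if "n \<ge> 1" for n
      by (rule distr_function[OF that centered_measurable])
    show "integrable P (\<lambda>\<omega>. (centered t (\<xi> 1 \<omega>))\<^sup>2)"
      by (rule centered_square(1))
    show "expectation (\<lambda>\<omega>. centered t (\<xi> 1 \<omega>)) = 0"
      by (rule expectation_centered)
  qed
  moreover have "(\<integral>z. iexp (\<Sum>i=1..d. t i * z i) \<partial>distr P (Rd d) (Z n))
      = (\<integral>\<omega>. iexp ((\<Sum>j=1..n. centered t (\<xi> j \<omega>)) / sqrt n) \<partial>P)" for n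
    unfolding Z_form[symmetric] by (rule integral_distr[OF Z_measurable]) measurable
  ultimately show ?thesis
    by (simp only: centered_square(2))
qed

text \<open>Normalization makes the variance of each coordinate of \<open>Z n\<close> independent of
  n for n at least 1. This is the uniform moment bound that keeps the truncation error
  small.\<close>

lemma second_moment_Z:
  assumes "i \<in> {1..d}"
  shows "integrable (distr P (Rd d) (Z n)) (\<lambda>z. (z i)\<^sup>2)"
    and "(\<integral>z. (z i)\<^sup>2 \<partial>distr P (Rd d) (Z n)) \<le> Cov P (\<xi> 1) i i"
proof -
  let ?h = "\<lambda>y. y i - \<mu> i"
  have h: "?h \<in> borel_measurable (Rd d)"
    using assms by (intro borel_measurable_diff measurable_component_singleton) auto
  have transfer: "integrable P (\<lambda>\<omega>. f (?h (\<xi> j \<omega>))) \<longleftrightarrow> integrable P (\<lambda>\<omega>. f (?h (\<xi> 1 \<omega>)))"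
    "expectation (\<lambda>\<omega>. f (?h (\<xi> j \<omega>))) = expectation (\<lambda>\<omega>. f (?h (\<xi> 1 \<omega>)))"
    if j: "j \<ge> 1" and f: "f \<in> borel_measurable borel" for j and f :: "real \<Rightarrow> real"
  proof -
    have m: "(\<lambda>\<omega>. ?h (\<xi> j \<omega>)) \<in> borel_measurable P" if "j \<ge> 1" for j
      using measurable_compose[OF rv[OF that] h] .
    show "integrable P (\<lambda>\<omega>. f (?h (\<xi> j \<omega>))) \<longleftrightarrow> integrable P (\<lambda>\<omega>. f (?h (\<xi> 1 \<omega>)))"
      using integrable_distr_eq[OF m[OF j] f] integrable_distr_eq[OF m[OF order_refl] f]
      unfolding distr_function[OF j h] by blast
    show "expectation (\<lambda>\<omega>. f (?h (\<xi> j \<omega>))) = expectation (\<lambda>\<omega>. f (?h (\<xi> 1 \<omega>)))"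
      using integral_distr[OF m[OF j] f] integral_distr[OF m[OF order_refl] f]
      unfolding distr_function[OF j h] by simp
  qed
  have sq: "integrable P (\<lambda>\<omega>. (\<Sum>j=1..n. \<xi> j \<omega> i - \<mu> i)\<^sup>2) \<and>
    expectation (\<lambda>\<omega>. (\<Sum>j=1..n. \<xi> j \<omega> i - \<mu> i)\<^sup>2) = (\<Sum>j=1..n. expectation (\<lambda>\<omega>. (\<xi> j \<omega> i - \<mu> i)\<^sup>2))"
  proof (rule expectation_sum_square)
    show "indep_vars (\<lambda>_. borel) (\<lambda>j \<omega>. \<xi> j \<omega> i - \<mu> i) {1..n}"
      using indep_function[OF h] by (rule indep_vars_subset) auto
    fix j assume "j \<in> {1..n}"
    then have j: "j \<ge> 1" by simp
    show "integrable P (\<lambda>\<omega>. (\<xi> j \<omega> i - \<mu> i)\<^sup>2)"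
      using transfer(1)[OF j, of "\<lambda>x. x\<^sup>2"] integrable_centered[OF assms assms] by (simp add: power2_eq_square)
    show "expectation (\<lambda>\<omega>. \<xi> j \<omega> i - \<mu> i) = 0"
      using transfer(2)[OF j, of "\<lambda>x. x"] integrable_component[OF assms] by (simp add: prob_space)
  qed simp
  have "expectation (\<lambda>\<omega>. (\<xi> j \<omega> i - \<mu> i)\<^sup>2) = Cov P (\<xi> 1) i i" if "j \<in> {1..n}" for j
    using transfer(2)[of j "\<lambda>x. x\<^sup>2"] that by (simp add: Cov_def power2_eq_square)
  then have total: "expectation (\<lambda>\<omega>. (\<Sum>j=1..n. \<xi> j \<omega> i - \<mu> i)\<^sup>2) = real n * Cov P (\<xi> 1) i i"
    using sq by simp
  have Z_sq: "(Z n \<omega> i)\<^sup>2 = (\<Sum>j=1..n. \<xi> j \<omega> i - \<mu> i)\<^sup>2 / real n" for \<omega>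
    using assms by (simp add: Z_def power_divide)
  have m: "(\<lambda>z. (z i)\<^sup>2) \<in> borel_measurable (Rd d)"
    using measurable_component_singleton[OF assms, of "\<lambda>_. borel"] by measurable
  show "integrable (distr P (Rd d) (Z n)) (\<lambda>z. (z i)\<^sup>2)"
    unfolding integrable_distr_eq[OF Z_measurable m] Z_sq using sq by simp
  have "(\<integral>z. (z i)\<^sup>2 \<partial>distr P (Rd d) (Z n)) = real n * Cov P (\<xi> 1) i i / real n"
    unfolding integral_distr[OF Z_measurable m] Z_sq using total by simp
  \<comment> \<open>Equality except at n = 0, where the left side is 0 by division by zero and the
    variance is nonnegative.\<close>
  also have "\<dots> \<le> Cov P (\<xi> 1) i i"
    by (cases "n = 0") (simp_all add: Cov_def)
  finally show "(\<integral>z. (z i)\<^sup>2 \<partial>distr P (Rd d) (Z n)) \<le> Cov P (\<xi> 1) i i" .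
qed

lemma multivariate_central_limit:
  assumes \<nu>: "normal_law d (\<lambda>_. 0) (Cov P (\<xi> 1)) \<nu>"
    and g: "g \<in> borel_measurable (Rd d)"
    and lip: "\<And>z w. \<bar>g z - g w\<bar> \<le> C * (\<Sum>i=1..d. \<bar>z i - w i\<bar>)" and C: "0 \<le> C"
    and bnd: "\<And>z. \<bar>g z\<bar> \<le> D"
  shows "(\<lambda>n. expectation (\<lambda>\<omega>. g (Z n \<omega>))) \<longlonglongrightarrow> (\<integral>z. g z \<partial>\<nu>)"
proof -
  have "(\<lambda>n. \<integral>z. g z \<partial>distr P (Rd d) (Z n)) \<longlonglongrightarrow> (\<integral>z. g z \<partial>\<nu>)"
  proof (rule char_tendsto_imp_integral_tendsto[OF _ _ _ _ _ second_moment_Z(1) _ g lip C bnd])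
    show "prob_space (distr P (Rd d) (Z n))" for n
      by (rule prob_space_distr[OF Z_measurable])
    show "prob_space \<nu>" "sets \<nu> = sets (Rd d)"
      using \<nu> by (simp_all add: normal_law_def)
    show "(\<lambda>n. \<integral>z. iexp (\<Sum>i=1..d. t i * z i) \<partial>distr P (Rd d) (Z n)) \<longlonglongrightarrow> (\<integral>z. iexp (\<Sum>i=1..d. t i * z i) \<partial>\<nu>)" for t
    proof -
      have "(\<integral>z. iexp (\<Sum>i=1..d. t i * z i) \<partial>\<nu>) =
          exp (- of_real ((\<Sum>i=1..d. \<Sum>k=1..d. t i * Cov P (\<xi> 1) i k * t k) / 2))"
        using \<nu> unfolding normal_law_def by simp
      then show ?thesis using char_Z_tendsto[of t] by (simp only:)
    qed
    \<comment> \<open>One bound has to serve all coordinates; the trace of the covariance matrix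
      dominates each diagonal entry.\<close>
    show "(\<integral>z. (z i)\<^sup>2 \<partial>distr P (Rd d) (Z n)) \<le> (\<Sum>i=1..d. Cov P (\<xi> 1) i i)" if i: "i \<in> {1..d}" for n i
    proof -
      have "Cov P (\<xi> 1) i i \<le> (\<Sum>i=1..d. Cov P (\<xi> 1) i i)"
        using i by (intro member_le_sum) (auto simp: Cov_def)
      with second_moment_Z(2)[OF i, of n] show ?thesis by linarith
    qed
  qed auto
  then show ?thesis
    unfolding integral_distr[OF Z_measurable g] .
qed

end

section \<open>Deviation of the averages from the mean\<close>

text \<open>The closed form of \<open>G\<close>: half the length of the interval times the l1 norm
  of \<open>z\<close> extended by minus the sum of its coordinates.\<close>

definition halfwidth_norm :: "nat \<Rightarrow> real \<Rightarrow> real \<Rightarrow> (nat \<Rightarrow> real) \<Rightarrow> real" where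
  "halfwidth_norm d a b z = (b - a) / 2 * ((\<Sum>i=1..d. \<bar>z i\<bar>) + \<bar>\<Sum>i=1..d. z i\<bar>)"

lemma halfwidth_norm_measurable [measurable]: "halfwidth_norm d a b \<in> borel_measurable (Rd d)"
  unfolding halfwidth_norm_def[abs_def] by measurable

text \<open>Reconciles \<open>Z n\<close>, which is undefined outside \<open>{1..d}\<close>, with
  the unrestricted deviation vector in the formula for \<open>kappa\<close>.\<close>

lemma halfwidth_norm_cong:
  assumes "\<And>i. i \<in> {1..d} \<Longrightarrow> z i = w i"
  shows "halfwidth_norm d a b z = halfwidth_norm d a b w"
proof -
  have "(\<Sum>i=1..d. \<bar>z i\<bar>) = (\<Sum>i=1..d. \<bar>w i\<bar>)" "(\<Sum>i=1..d. z i) = (\<Sum>i=1..d. w i)"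
    using assms by (auto intro: sum.cong)
  then show ?thesis by (simp only: halfwidth_norm_def)
qed

lemma halfwidth_norm_scale:
  "0 \<le> c \<Longrightarrow> halfwidth_norm d a b (\<lambda>i. c * z i) = c * halfwidth_norm d a b z"
  by (simp add: halfwidth_norm_def abs_mult algebra_simps flip: sum_distrib_left)

lemma halfwidth_norm_lipschitz:
  assumes "a \<le> b"
  shows "\<bar>halfwidth_norm d a b z - halfwidth_norm d a b w\<bar> \<le> (b - a) * (\<Sum>i=1..d. \<bar>z i - w i\<bar>)"
proof -
  let ?D = "\<Sum>i=1..d. \<bar>z i - w i\<bar>"
  have "\<bar>(\<Sum>i=1..d. \<bar>z i\<bar>) - (\<Sum>i=1..d. \<bar>w i\<bar>)\<bar> \<le> ?D"
    unfolding sum_subtractf[symmetric] by (intro order_trans[OF sum_abs sum_mono]) linarith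
  moreover have "\<bar>\<bar>\<Sum>i=1..d. z i\<bar> - \<bar>\<Sum>i=1..d. w i\<bar>\<bar> \<le> ?D"
  proof -
    have "\<bar>\<bar>\<Sum>i=1..d. z i\<bar> - \<bar>\<Sum>i=1..d. w i\<bar>\<bar> \<le> \<bar>\<Sum>i=1..d. z i - w i\<bar>"
      unfolding sum_subtractf by linarith
    also have "\<dots> \<le> ?D" by (rule sum_abs)
    finally show ?thesis .
  qed
  ultimately have "\<bar>((\<Sum>i=1..d. \<bar>z i\<bar>) + \<bar>\<Sum>i=1..d. z i\<bar>) - ((\<Sum>i=1..d. \<bar>w i\<bar>) + \<bar>\<Sum>i=1..d. w i\<bar>)\<bar> \<le> 2 * ?D"
    by linarith
  then have "(b - a) / 2 * \<bar>((\<Sum>i=1..d. \<bar>z i\<bar>) + \<bar>\<Sum>i=1..d. z i\<bar>) - ((\<Sum>i=1..d. \<bar>w i\<bar>) + \<bar>\<Sum>i=1..d. w i\<bar>)\<bar>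
      \<le> (b - a) / 2 * (2 * ?D)"
    using assms by (intro mult_left_mono) auto
  then show ?thesis
    using assms unfolding halfwidth_norm_def right_diff_distrib[symmetric] abs_mult by simp
qed

text \<open>A continuous step is an affine function clamped to the unit interval, and clamping does
  not increase distances.\<close>

lemma cts_step_lipschitz:
  assumes "x < y"
  shows "\<bar>cts_step x y u - cts_step x y v\<bar> \<le> \<bar>u - v\<bar> / (y - x)"
proof -
  have "cts_step x y u = min 1 (max 0 ((y - u) / (y - x)))" for u
    using assms by (auto simp: cts_step_def field_simps min_def max_def)
  moreover have "\<bar>min 1 (max 0 r) - min 1 (max 0 s)\<bar> \<le> \<bar>r - s\<bar>" for r s :: real
    by (simp add: min_def max_def)
  ultimately have "\<bar>cts_step x y u - cts_step x y v\<bar> \<le> \<bar>(y - u) / (y - x) - (y - v) / (y - x)\<bar>"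
    by (simp only:)
  also have "\<dots> = \<bar>u - v\<bar> / (y - x)"
    using assms by (simp add: diff_divide_distrib[symmetric] abs_minus_commute)
  finally show ?thesis .
qed

text \<open>The limit law ranges over every \<open>\<nu>\<close> with the normal characteristic
  function; the separate existence clause keeps that part from being vacuous.\<close>

theorem theorem3p3:
  fixes P :: "'w measure" and p :: nat and I :: "real set"
    and \<xi> :: "nat \<Rightarrow> 'w \<Rightarrow> nat \<Rightarrow> real"
    and m\<^sub>0 :: "(nat \<Rightarrow> real) \<Rightarrow> real"
    and M :: "nat \<Rightarrow> 'w \<Rightarrow> (nat \<Rightarrow> real) \<Rightarrow> real"
  assumes "prob_space P"
    and "p \<ge> 2"
    and "is_interval I" "compact I" "\<exists>x\<in>I. \<exists>y\<in>I. x \<noteq> y"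
    and "prob_space.indep_vars P (\<lambda>_. Rd (p - 1)) \<xi> {1..}"
    and "\<forall>n\<ge>1. distr P (Rd (p - 1)) (\<xi> n) = distr P (Rd (p - 1)) (\<xi> 1)"
    and "\<forall>n\<ge>1. \<forall>\<omega>\<in>space P. \<forall>i\<in>{1..p-1}. \<xi> n \<omega> i \<ge> 0"
    and "\<P>(\<omega> in P. (\<Sum>i=1..p-1. \<xi> 1 \<omega> i) \<le> 1) = 1"
    \<comment> \<open>On the null event where the coordinates of \<open>\<xi> n \<omega>\<close> sum to more than 1, the formula for
        \<open>M n \<omega>\<close> does not define a mean; there \<open>M n \<omega>\<close> is an arbitrary fixed mean.\<close>
    and "m\<^sub>0 \<in> means p I"
    and "\<forall>n\<ge>1. \<forall>\<omega>\<in>space P. M n \<omega> =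
           (if (\<Sum>i=1..p-1. \<xi> n \<omega> i) \<le> 1
            then (\<lambda>x\<in>cube p I. (\<Sum>i=1..p-1. \<xi> n \<omega> i * x i) + (1 - (\<Sum>i=1..p-1. \<xi> n \<omega> i)) * x p)
            else m\<^sub>0)"
  shows "(\<forall>n\<ge>1. random_mean P p I (p - 1) (\<xi> n) (M n)) \<and>
    bochner_expectation P p I (M 1) =
      (\<lambda>x\<in>cube p I. (\<Sum>i=1..p-1. x i * (\<integral>\<omega>. \<xi> 1 \<omega> i \<partial>P))
                     + x p * (1 - (\<Sum>i=1..p-1. \<integral>\<omega>. \<xi> 1 \<omega> i \<partial>P))) \<and>
    \<P>(\<omega> in P. (\<lambda>n. kappa P p I M n \<omega>) \<longlonglongrightarrow> 0) = 1 \<and>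
    (\<exists>\<nu>. normal_law (p - 1) (\<lambda>_. 0) (Cov P (\<xi> 1)) \<nu>) \<and>
    (\<forall>\<nu>. normal_law (p - 1) (\<lambda>_. 0) (Cov P (\<xi> 1)) \<nu> \<longrightarrow>
       weak_conv_m (\<lambda>n. distr P borel (\<lambda>\<omega>. sqrt (real n) * kappa P p I M n \<omega>))
         (distr \<nu> borel (\<lambda>z. SUP x\<in>cube p I. \<bar>\<Sum>i=1..p-1. z i * (x i - x p)\<bar>)))"
proof -
  interpret prob_space P by fact
  define d where "d = p - 1"
  obtain a b where I: "I = {a..b}"
    using assms(3,4) by (metis connected_compact_interval_1 is_interval_connected_1)
  have ab: "a < b" using assms(5) unfolding I by force
  have m0: "m\<^sub>0 \<in> means p {a..b}" "m\<^sub>0 \<in> mspace (CI p {a..b})"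
    using assms(10) unfolding I means_def by auto
  have le1: "AE \<omega> in P. (\<Sum>i=1..d. \<xi> 1 \<omega> i) \<le> 1"
  proof -
    have "\<xi> 1 \<in> P \<rightarrow>\<^sub>M Rd d"
      using assms(6) unfolding indep_vars_def2 d_def by auto
    moreover have "{y \<in> space (Rd d). (\<Sum>i=1..d. y i) \<le> 1} \<in> sets (Rd d)" by measurable
    ultimately have "\<xi> 1 -` {y \<in> space (Rd d). (\<Sum>i=1..d. y i) \<le> 1} \<inter> space P \<in> sets P"
      by (rule measurable_sets)
    also have "\<xi> 1 -` {y \<in> space (Rd d). (\<Sum>i=1..d. y i) \<le> 1} \<inter> space P
        = {\<omega> \<in> space P. (\<Sum>i=1..d. \<xi> 1 \<omega> i) \<le> 1}"
      using measurable_space[OF \<open>\<xi> 1 \<in> P \<rightarrow>\<^sub>M Rd d\<close>] by blast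
    finally show ?thesis
      using assms(9) unfolding d_def by (simp only: prob_Collect_eq_1)
  qed
  interpret iid_weights P d \<xi>
  proof unfold_locales
    show "indep_vars (\<lambda>_. Rd d) \<xi> {1..}"
      using assms(6) by (simp only: d_def)
    show "distr P (Rd d) (\<xi> n) = distr P (Rd d) (\<xi> 1)" if "n \<ge> 1" for n
      using assms(7) that unfolding d_def by blast
    show "0 \<le> \<xi> n \<omega> i" if "n \<ge> 1" "\<omega> \<in> space P" "i \<in> {1..d}" for n \<omega> i
      using assms(8) that unfolding d_def by blast
  qed (rule le1)
  let ?good = "\<lambda>n \<omega>. (\<Sum>i=1..p-1. \<xi> n \<omega> i) \<le> 1"
  have M: "M n \<omega> = (if ?good n \<omega> then weighted_mean p {a..b} (\<xi> n \<omega>) else m\<^sub>0)"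
    if "n \<ge> 1" "\<omega> \<in> space P" for n \<omega>
    using assms(11) that unfolding I weighted_mean_def by blast
  have random: "random_mean P p {a..b} (p - 1) (\<xi> n) (M n)" if n: "n \<ge> 1" for n
    using prob_space_axioms assms(2) less_imp_le[OF ab] rv[OF n, unfolded d_def] nonneg[OF n, unfolded d_def] m0(1) M[OF n]
    by (rule random_mean_weighted)
  have M_means: "M n \<omega> \<in> means p {a..b}" and M_mspace: "M n \<omega> \<in> mspace (CI p {a..b})"
    and M_cont: "continuous_map (cube_topology p {a..b}) euclideanreal (M n \<omega>)"
    if "n \<ge> 1" "\<omega> \<in> space P" for n \<omega>
  proof -
    show "M n \<omega> \<in> means p {a..b}"
      using random[OF that(1)] that(2) unfolding random_mean_def by blast
    then show "M n \<omega> \<in> mspace (CI p {a..b})"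
      unfolding means_def by blast
    then show "continuous_map (cube_topology p {a..b}) euclideanreal (M n \<omega>)"
      by (simp only: mspace_CI[OF compact_Icc])
  qed
  have M_meas: "(\<lambda>\<omega>. M n \<omega> x) \<in> borel_measurable P" if n: "n \<ge> 1" and x: "x \<in> cube p {a..b}" for n x
  proof -
    have "(\<lambda>\<omega>. if ?good n \<omega> then x p + difference_form p (\<xi> n \<omega>) x else m\<^sub>0 x) \<in> borel_measurable P"
    proof (rule measurable_If)
      have m: "(\<lambda>\<omega>. \<xi> n \<omega> i) \<in> borel_measurable P" if "i \<in> {1..p-1}" for i
        using rv_component[OF n] that unfolding d_def by blast
      show "(\<lambda>\<omega>. x p + difference_form p (\<xi> n \<omega>) x) \<in> borel_measurable P"
        unfolding difference_form_def
        by (intro borel_measurable_add borel_measurable_sum borel_measurable_times measurable_const m) simp_all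
      show "{\<omega> \<in> space P. ?good n \<omega>} \<in> sets P"
        using borel_measurable_sum[OF m] by measurable
    qed simp
    then show ?thesis
      by (rule measurable_cong[THEN iffD1, rotated]) (simp only: M[OF n] weighted_mean_apply[OF x] if_distrib[of "\<lambda>f. f x"])
  qed
  have EM: "bochner_expectation P p {a..b} (M 1) = weighted_mean p {a..b} \<mu>"
  proof (rule bochner_expectation_eqI[OF prob_space_axioms])
    show "has_bochner_expectation P p {a..b} (M 1) (weighted_mean p {a..b} \<mu>)"
    proof (rule has_bochner_expectation_weighted[OF prob_space_axioms assms(2) less_imp_le[OF ab]
          rv[OF order_refl, unfolded d_def] nonneg[OF order_refl, unfolded d_def] le1[unfolded d_def] m0(2)
          M[OF order_refl]])
      show "M 1 \<in> P \<rightarrow>\<^sub>M borel_of (mtopology_of (CI p {a..b}))"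
        using random[OF order_refl] unfolding random_mean_def by blast
    qed
    show "M 1 \<omega> \<in> mspace (CI p {a..b})" if "\<omega> \<in> space P" for \<omega>
      using that by (rule M_mspace[OF order_refl])
    show "integrable P (\<lambda>\<omega>. M 1 \<omega> x)" if x: "x \<in> cube p {a..b}" for x
    proof (rule integrable_const_bound[of _ "\<bar>a\<bar> + \<bar>b\<bar>"])
      show "AE \<omega> in P. norm (M 1 \<omega> x) \<le> \<bar>a\<bar> + \<bar>b\<bar>"
        using AE_space
      proof eventually_elim
        case (elim \<omega>)
        show ?case
          using means_in_interval[OF M_means[OF order_refl elim] x] assms(2) by auto
      qed
    qed (rule M_meas[OF order_refl x])
  qed
  \<comment> \<open>Argued from the definition on all of the space, since the closed form of
    \<open>kappa\<close> is available only off a null set.\<close>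
  have kappa_meas: "kappa P p {a..b} M n \<in> borel_measurable P" for n
    unfolding kappa_def[abs_def] EM
  proof (rule borel_measurable_SUP_cube)
    show "compact {a..b}" "{a..b} \<noteq> {}" using ab by auto
    show "(\<lambda>\<omega>. \<bar>1 / real n * (\<Sum>j=1..n. M j \<omega> x) - weighted_mean p {a..b} \<mu> x\<bar>) \<in> borel_measurable P"
      if "x \<in> cube p {a..b}" for x
      using that
      by (intro borel_measurable_abs borel_measurable_diff borel_measurable_times borel_measurable_sum
          measurable_const M_meas) simp_all
    show "continuous_map (cube_topology p {a..b}) euclideanreal
        (\<lambda>x. \<bar>1 / real n * (\<Sum>j=1..n. M j \<omega> x) - weighted_mean p {a..b} \<mu> x\<bar>)"
      if "\<omega> \<in> space P" for \<omega>
    proof -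
      have "continuous_map (cube_topology p {a..b}) euclideanreal (weighted_mean p {a..b} \<mu>)"
        using weighted_mean_in_mspace[OF assms(2) compact_Icc] by (simp only: mspace_CI[OF compact_Icc])
      then show ?thesis
        using that by (intro continuous_map_real_abs continuous_map_diff continuous_map_real_mult_left
            continuous_map_sum M_cont) simp_all
    qed
  qed
  let ?G = "halfwidth_norm d a b"
  have SUP_eq: "(SUP x\<in>cube p {a..b}. \<bar>difference_form p z x\<bar>) = ?G z" for z
    unfolding halfwidth_norm_def d_def using less_imp_le[OF ab] assms(2) by (rule SUP_abs_difference_form)
  \<comment> \<open>The terms \<open>x p\<close> of the average and of the expectation cancel. This
    takes n at least 1: at n = 0 the average is 0 by division by zero.\<close>
  have kappa_eq: "kappa P p {a..b} M n \<omega> = ?G (\<lambda>i. (\<Sum>j=1..n. \<xi> j \<omega> i) / real n - \<mu> i)"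
    if n: "n \<ge> 1" and \<omega>: "\<omega> \<in> space P" and good: "\<forall>j\<in>{1..}. (\<Sum>i=1..d. \<xi> j \<omega> i) \<le> 1" for n \<omega>
  proof -
    have "1 / real n * (\<Sum>j=1..n. M j \<omega> x) - weighted_mean p {a..b} \<mu> x
        = difference_form p (\<lambda>i. (\<Sum>j=1..n. \<xi> j \<omega> i) / real n - \<mu> i) x" if x: "x \<in> cube p {a..b}" for x
    proof -
      have "M j \<omega> x = x p + difference_form p (\<xi> j \<omega>) x" if "j \<in> {1..n}" for j
      proof -
        have "j \<ge> 1" "?good j \<omega>" using that good unfolding d_def by auto
        then show ?thesis
          unfolding M[OF \<open>j \<ge> 1\<close> \<omega>] by (simp only: if_True weighted_mean_apply[OF x])
      qed
      then have "(\<Sum>j=1..n. M j \<omega> x) = real n * x p + (\<Sum>j=1..n. difference_form p (\<xi> j \<omega>) x)"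
        by (simp add: sum.distrib)
      also have "(\<Sum>j=1..n. difference_form p (\<xi> j \<omega>) x) = difference_form p (\<lambda>i. \<Sum>j=1..n. \<xi> j \<omega> i) x"
        unfolding difference_form_def sum_distrib_right by (rule sum.swap)
      finally have "1 / real n * (\<Sum>j=1..n. M j \<omega> x)
          = x p + 1 / real n * difference_form p (\<lambda>i. \<Sum>j=1..n. \<xi> j \<omega> i) x"
        using n by (simp add: distrib_left)
      also have "1 / real n * difference_form p (\<lambda>i. \<Sum>j=1..n. \<xi> j \<omega> i) x
          = difference_form p (\<lambda>i. (\<Sum>j=1..n. \<xi> j \<omega> i) / real n) x"
        unfolding difference_form_def sum_distrib_left by simp
      finally show ?thesis
        by (simp only: weighted_mean_apply[OF x] difference_form_diff[symmetric])
    qed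
    then show ?thesis
      unfolding kappa_def EM SUP_eq[symmetric] by (intro SUP_cong refl) simp
  qed

  \<comment> \<open>Almost sure convergence\<close>
  have lim: "AE \<omega> in P. (\<lambda>n. kappa P p {a..b} M n \<omega>) \<longlonglongrightarrow> 0"
  proof -
    have "AE \<omega> in P. \<forall>i\<in>{1..d}. (\<lambda>n. (\<Sum>j=1..n. \<xi> j \<omega> i) / real n) \<longlonglongrightarrow> \<mu> i"
      using strong_law by (intro AE_finite_allI) auto
    with AE_le1 AE_space show ?thesis
    proof eventually_elim
      case (elim \<omega>)
      let ?z = "\<lambda>n i. (\<Sum>j=1..n. \<xi> j \<omega> i) / real n - \<mu> i"
      have "(\<lambda>n. (b - a) * (\<Sum>i=1..d. \<bar>?z n i\<bar>)) \<longlonglongrightarrow> (b - a) * (\<Sum>i=1..d. \<bar>\<mu> i - \<mu> i\<bar>)"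
        using elim(3) by (intro tendsto_intros) blast
      then have lim0: "(\<lambda>n. (b - a) * (\<Sum>i=1..d. \<bar>?z n i\<bar>)) \<longlonglongrightarrow> 0" by simp
      have "(\<lambda>n. ?G (?z n)) \<longlonglongrightarrow> 0"
      proof (rule Lim_null_comparison[OF _ lim0], intro always_eventually allI)
        \<comment> \<open>Since \<open>?G\<close> vanishes at the zero vector, its Lipschitz
          estimate against that vector bounds \<open>?G\<close> itself.\<close>
        show "norm (?G (?z n)) \<le> (b - a) * (\<Sum>i=1..d. \<bar>?z n i\<bar>)" for n
          using halfwidth_norm_lipschitz[OF less_imp_le[OF ab], of d "?z n" "\<lambda>_. 0"]
          by (simp add: halfwidth_norm_def[of d a b "\<lambda>_. 0"])
      qed
      moreover have "\<forall>\<^sub>F n in sequentially. ?G (?z n) = kappa P p {a..b} M n \<omega>"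
        using eventually_ge_at_top[of 1] by eventually_elim (intro kappa_eq[symmetric] elim(1,2))
      ultimately show ?case by (rule Lim_transform_eventually)
    qed
  qed

  \<comment> \<open>Convergence in distribution\<close>
  have weak: "weak_conv_m (\<lambda>n. distr P borel (\<lambda>\<omega>. sqrt (real n) * kappa P p {a..b} M n \<omega>)) (distr \<nu> borel ?G)"
    if \<nu>: "normal_law d (\<lambda>_. 0) (Cov P (\<xi> 1)) \<nu>" for \<nu>
  proof (rule integral_cts_step_conv_imp_weak_conv)
    have \<nu>_prob: "prob_space \<nu>" and \<nu>_sets: "sets \<nu> = sets (Rd d)"
      using \<nu> by (simp_all add: normal_law_def)
    have G_\<nu>: "?G \<in> borel_measurable \<nu>"
      using halfwidth_norm_measurable[of d a b] by (simp cong: measurable_cong_sets add: \<nu>_sets)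
    have scaled_meas: "(\<lambda>\<omega>. sqrt (real n) * kappa P p {a..b} M n \<omega>) \<in> borel_measurable P" for n
      using kappa_meas[of n] by measurable
    show "real_distribution (distr P borel (\<lambda>\<omega>. sqrt (real n) * kappa P p {a..b} M n \<omega>))" for n
      by (rule real_distribution_distr[OF scaled_meas])
    show "real_distribution (distr \<nu> borel ?G)"
      by (rule prob_space.real_distribution_distr[OF \<nu>_prob G_\<nu>])
    fix x y :: real assume xy: "x < y"
    have step: "cts_step x y \<in> borel_measurable borel"
      by (auto simp: cts_step_def[abs_def])
    let ?g = "\<lambda>z. cts_step x y (?G z)"
    have g: "?g \<in> borel_measurable (Rd d)"
      by (rule measurable_compose[OF halfwidth_norm_measurable step])
    have "(\<lambda>n. expectation (\<lambda>\<omega>. ?g (Z n \<omega>))) \<longlonglongrightarrow> (\<integral>z. ?g z \<partial>\<nu>)"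
    proof (rule multivariate_central_limit[OF \<nu> g])
      show "\<bar>?g z - ?g w\<bar> \<le> (b - a) / (y - x) * (\<Sum>i=1..d. \<bar>z i - w i\<bar>)" for z w
      proof -
        have "\<bar>?g z - ?g w\<bar> \<le> \<bar>?G z - ?G w\<bar> / (y - x)"
          using xy by (rule cts_step_lipschitz)
        also have "\<dots> \<le> (b - a) * (\<Sum>i=1..d. \<bar>z i - w i\<bar>) / (y - x)"
          using xy ab by (intro divide_right_mono halfwidth_norm_lipschitz) auto
        finally show ?thesis by simp
      qed
      show "0 \<le> (b - a) / (y - x)" using xy ab by simp
      show "\<bar>?g z\<bar> \<le> 1" for z using xy by (simp add: cts_step_def)
    qed
    moreover have "\<forall>\<^sub>F n in sequentially. expectation (\<lambda>\<omega>. ?g (Z n \<omega>))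
        = integral\<^sup>L (distr P borel (\<lambda>\<omega>. sqrt (real n) * kappa P p {a..b} M n \<omega>)) (cts_step x y)"
      using eventually_ge_at_top[of 1]
    proof eventually_elim
      case (elim n)
      have "expectation (\<lambda>\<omega>. ?g (Z n \<omega>)) = expectation (\<lambda>\<omega>. cts_step x y (sqrt (real n) * kappa P p {a..b} M n \<omega>))"
      proof (rule integral_cong_AE)
        show "(\<lambda>\<omega>. ?g (Z n \<omega>)) \<in> borel_measurable P"
          by (rule measurable_compose[OF Z_measurable g])
        show "(\<lambda>\<omega>. cts_step x y (sqrt (real n) * kappa P p {a..b} M n \<omega>)) \<in> borel_measurable P"
          by (rule measurable_compose[OF scaled_meas step])
        show "AE \<omega> in P. ?g (Z n \<omega>) = cts_step x y (sqrt (real n) * kappa P p {a..b} M n \<omega>)"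
          using AE_le1 AE_space
        proof eventually_elim
          case (elim \<omega>)
          let ?z = "\<lambda>i. (\<Sum>j=1..n. \<xi> j \<omega> i) / real n - \<mu> i"
          have "Z n \<omega> i = sqrt (real n) * ?z i" if "i \<in> {1..d}" for i
          proof -
            \<comment> \<open>Stated for a free \<open>s\<close>, so that the algebra is settled
              before \<open>s * s\<close> becomes \<open>real n\<close> at
              \<open>s = sqrt (real n)\<close>.\<close>
            have "s * (S / (s * s) - m) = (S - s * s * m) / s" if "s > 0" for s S m :: real
              using that by (simp add: field_simps)
            from this[of "sqrt (real n)" "\<Sum>j=1..n. \<xi> j \<omega> i" "\<mu> i"]
            have "sqrt (real n) * ?z i = ((\<Sum>j=1..n. \<xi> j \<omega> i) - real n * \<mu> i) / sqrt (real n)"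
              using \<open>1 \<le> n\<close> by simp
            then show ?thesis
              using that by (simp add: Z_def sum_subtractf)
          qed
          \<comment> \<open>Positive homogeneity; together with \<open>kappa_eq\<close> it
            identifies \<open>sqrt n\<close> times \<open>kappa\<close> with \<open>?G (Z n)\<close>
            almost surely.\<close>
          then have "?G (Z n \<omega>) = sqrt (real n) * ?G ?z"
            using halfwidth_norm_cong[of d "Z n \<omega>" "\<lambda>i. sqrt (real n) * ?z i" a b]
            by (simp only: halfwidth_norm_scale[OF real_sqrt_ge_zero[OF of_nat_0_le_iff]])
          then show ?case
            by (simp only: kappa_eq[OF \<open>1 \<le> n\<close> elim(2,1)])
        qed
      qed
      then show ?case
        by (simp only: integral_distr[OF scaled_meas step])
    qed
    ultimately have "(\<lambda>n. integral\<^sup>L (distr P borel (\<lambda>\<omega>. sqrt (real n) * kappa P p {a..b} M n \<omega>)) (cts_step x y))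
        \<longlonglongrightarrow> (\<integral>z. ?g z \<partial>\<nu>)"
      by (rule Lim_transform_eventually)
    then show "(\<lambda>n. integral\<^sup>L (distr P borel (\<lambda>\<omega>. sqrt (real n) * kappa P p {a..b} M n \<omega>)) (cts_step x y))
        \<longlonglongrightarrow> integral\<^sup>L (distr \<nu> borel ?G) (cts_step x y)"
      by (simp only: integral_distr[OF G_\<nu> step])
  qed
  show ?thesis
  proof (intro conjI)
    show "\<forall>n\<ge>1. random_mean P p I (p - 1) (\<xi> n) (M n)"
      using random unfolding I by blast
    show "bochner_expectation P p I (M 1) =
      (\<lambda>x\<in>cube p I. (\<Sum>i=1..p-1. x i * (\<integral>\<omega>. \<xi> 1 \<omega> i \<partial>P)) + x p * (1 - (\<Sum>i=1..p-1. \<integral>\<omega>. \<xi> 1 \<omega> i \<partial>P)))"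
      unfolding I EM weighted_mean_def by (simp only: mult.commute)
    have "{\<omega> \<in> space P. (\<lambda>n. kappa P p I M n \<omega>) \<longlonglongrightarrow> 0} \<in> sets P"
      unfolding I using kappa_meas by measurable
    then show "\<P>(\<omega> in P. (\<lambda>n. kappa P p I M n \<omega>) \<longlonglongrightarrow> 0) = 1"
      using lim unfolding I by (simp only: prob_Collect_eq_1)
    show "\<exists>\<nu>. normal_law (p - 1) (\<lambda>_. 0) (Cov P (\<xi> 1)) \<nu>"
      using normal_law_Cov_exists unfolding d_def .
    have "(\<lambda>z. SUP x\<in>cube p I. \<bar>\<Sum>i=1..p-1. z i * (x i - x p)\<bar>) = ?G"
      unfolding I SUP_eq[symmetric, abs_def] difference_form_def ..
    then show "\<forall>\<nu>. normal_law (p - 1) (\<lambda>_. 0) (Cov P (\<xi> 1)) \<nu> \<longrightarrow>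
       weak_conv_m (\<lambda>n. distr P borel (\<lambda>\<omega>. sqrt (real n) * kappa P p I M n \<omega>))
         (distr \<nu> borel (\<lambda>z. SUP x\<in>cube p I. \<bar>\<Sum>i=1..p-1. z i * (x i - x p)\<bar>))"
      using weak unfolding I d_def by simp
  qed
qed

end
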